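(* Let $n\geq 5$, and let $\prec$ be a term order on $S_n$ of the type described in the context. Then the initial ideal of $J_n$ with respect to $\prec$ is equal to the Stanley-Reisner ideal of the simplicial complex $\mathcal{K}_n * \Delta_{2n-4}$.
   Context: Let $\mathbb{K}$ be an algebraically closed field and $S_n=\mathbb{K}[x_{ij},y_1,\ldots,y_n]_{1\leq i<j\leq n}$. Put $x_{ji}=-x_{ij}$ for $i<j$ and $x_{ii}=0$. The ideal $J_n$: for $1\leq i<j<k<l\leq n$ let $\Phi_{ijkl}=x_{ij}x_{kl}-x_{ik}x_{jl}+x_{il}x_{jk}$, and for $1\leq i\leq n$ let $f_i=\sum_{j=1}^n x_{ij}y_j$. Then $J_n\subset S_n$ is the ideal generated by all $\Phi_{ijkl}$ ($1\leq i<j<k<l\leq n$) and $f_1,\ldots,f_n$. Simplicial complexes: an (abstract) simplicial complex on a finite set $V$ is a set of subsets of $V$ closed under taking subsets. Its Stanley-Reisner ideal is the ideal of $\mathbb{K}[x_i\mid i\in V]$ generated by the monomials $\prod_{i\in p}x_i$ for all $p\subseteq V$ that are not faces. The simplex $\Delta_m$ is the power set of $\{0,\ldots,m\}$. The join of complexes on disjoint sets is $\mathcal{K}*\mathcal{L}=\{f\cup g\mid f\in\mathcal{K},\ g\in\mathcal{L}\}$. For a face $f\in \mathcal{K}$ of dimension at least one (i.e. with at least two elements), the stellar subdivision of $\mathcal{K}$ at $f$ is $$\mathrm{st}(f,\mathcal{K})=\{g\in\mathcal{K}\mid f\not\subseteq g\}\cup\{g\cup\{v\}\mid g\in \mathcal{K},\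 f\not\subseteq g,\ f\cup g\in\mathcal{K}\},$$ where $v$ is a new vertex. The complex $\mathcal{K}_n$: label the vertices of the $n$-gon cyclically $1,\ldots,n$, and let $\delta_{ij}$ be the diagonal joining (non-adjacent) vertices $i$ and $j$. Let $\mathcal{A}_n$ be the simplicial complex on the set of all $\frac12 n(n-3)$ diagonals whose faces are the sets of pairwise non-crossing diagonals. Let $S^0$ be the complex consisting of two vertices $w_1,w_2$ and no edge. Then $\mathcal{K}_n=\mathrm{st}(f,\mathcal{A}_n*S^0)$, where $f=\{\delta_{1(n-1)},w_1\}$. Denote by $v$ the new vertex. Vertices of $\mathcal{K}_n*\Delta_{2n-4}$ correspond to variables of $S_n$ as follows: $\delta_{ij}\leftrightarrow x_{ij}$, $w_1\leftrightarrow y_1$, $v\leftrightarrow y_n$, $w_2\leftrightarrow x_{1n}$, and the $2n-3$ vertices of $\Delta_{2n-4}$ correspond to $x_{12},x_{23},\ldots,x_{(n-1)n},y_2,\ldots,y_{n-1}$. Term order: a monomial order on $\mathbb{K}[x_{ij}]$ is called circular if for all $1\leq i<j<k<l\leq n$ it selects $x_{ik}x_{jl}$ as leading term of $\Phi_{ijkl}$. The term order $\prec$ on $S_n$ compares monomials by the following criteria, each one used only to break ties in the preceding ones: (i) a monomial of smaller total degree is smaller; (ii) a monomial of larger total degree in the variables $y_2,\ldots,y_{n-1}$ is smaller; (iii) a monomial of larger degree in $x_{(n-1)n}$ is smaller; (iv) lexicographically, with all $x$-variables $\prec y_{n-1}\prec y_{n-2}\prec\cdots\prec y_2\prec y_1\prec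 y_n$ (i.e. lexicographic comparison of the exponents of the $y$-variables, no comparison among $x$-variables being made at this step); (v) remaining ties (monomials differing only in their $x$-parts) are broken by any fixed circular order compatible with (iii), meaning that among $x$-monomials of the same total degree those with larger degree in $x_{(n-1)n}$ are smaller. *)

theory Defs
  imports
    "HOL-Library.Poly_Mapping"
    "HOL-Computational_Algebra.Polynomial"
    "HOL-Algebra.Ideal"
begin

section \<open>Polynomial rings, monomial orders and initial ideals\<close>

text \<open>
  A monomial in variables of type \<open>'v\<close> is its exponent vector (so that multiplication of
  monomials is addition of exponent vectors); a polynomial is a finitely supported map from
  monomials to coefficients, multiplied by convolution.
\<close>

type_synonym 'v monomial = "'v \<Rightarrow>\<^sub>0 nat"
type_synonym ('v, 'k) mpoly = "'v monomial \<Rightarrow>\<^sub>0 'k"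

definition monomials :: "'v set \<Rightarrow> 'v monomial set" where
  "monomials V = {m. Poly_Mapping.keys m \<subseteq> V}"

definition pvar :: "'v \<Rightarrow> ('v, 'k::comm_ring_1) mpoly" where
  "pvar v = Poly_Mapping.single (Poly_Mapping.single v 1) 1"

text \<open>The polynomial ring \<open>\<bbbK>[v | v \<in> V]\<close>, with \<open>\<bbbK>\<close> the coefficient type.\<close>

definition poly_ring :: "'v set \<Rightarrow> ('v, 'k::comm_ring_1) mpoly ring" where
  "poly_ring V =
    \<lparr> carrier = {p. Poly_Mapping.keys p \<subseteq> monomials V},
      monoid.mult = (*), one = 1, ring.zero = 0, add = (+) \<rparr>"

lemma cring_poly_ring: "cring (poly_ring V :: ('v, 'k::comm_ring_1) mpoly ring)"
proof -
  let ?C = "{p :: ('v, 'k) mpoly. Poly_Mapping.keys p \<subseteq> monomials V}"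
  have mult: "p * q \<in> ?C" if "p \<in> ?C" "q \<in> ?C" for p q
    using keys_mult[of p q] keys_add that by (fastforce simp: monomials_def)
  have add: "p + q \<in> ?C" if "p \<in> ?C" "q \<in> ?C" for p q
    using keys_add[of p q] that by auto
  have one: "1 \<in> ?C"
    by (simp add: monomials_def)
  show ?thesis
  proof (intro cringI abelian_groupI comm_monoidI)
    fix p assume "p \<in> carrier (poly_ring V :: ('v, 'k) mpoly ring)"
    then show "\<exists>q\<in>carrier (poly_ring V). q \<oplus>\<^bsub>poly_ring V\<^esub> p = \<zero>\<^bsub>poly_ring V\<^esub>"
      by (intro bexI[of _ "- p"]) (auto simp: poly_ring_def in_keys_iff)
  qed (use mult add one in \<open>auto simp: poly_ring_def algebra_simps\<close>)
qed

definition monomial_order :: "'v set \<Rightarrow> ('v monomial \<Rightarrow> 'v monomial \<Rightarrow> bool) \<Rightarrow> bool" where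
  "monomial_order V lt \<longleftrightarrow>
     (\<forall>a\<in>monomials V. \<not> lt a a) \<and>
     (\<forall>a\<in>monomials V. \<forall>b\<in>monomials V. \<forall>c\<in>monomials V. lt a b \<longrightarrow> lt b c \<longrightarrow> lt a c) \<and>
     (\<forall>a\<in>monomials V. \<forall>b\<in>monomials V. a \<noteq> b \<longrightarrow> lt a b \<or> lt b a) \<and>
     (\<forall>a\<in>monomials V. \<forall>b\<in>monomials V. \<forall>c\<in>monomials V. lt a b \<longrightarrow> lt (a + c) (b + c)) \<and>
     (\<forall>a\<in>monomials V. a \<noteq> 0 \<longrightarrow> lt 0 a)"

definition lead_monomial ::
    "('v monomial \<Rightarrow> 'v monomial \<Rightarrow> bool) \<Rightarrow> ('v, 'k::zero) mpoly \<Rightarrow> 'v monomial" where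
  "lead_monomial lt p =
     (THE m. m \<in> Poly_Mapping.keys p \<and> (\<forall>m'\<in>Poly_Mapping.keys p. m' \<noteq> m \<longrightarrow> lt m' m))"

definition initial_ideal ::
    "'v set \<Rightarrow> ('v monomial \<Rightarrow> 'v monomial \<Rightarrow> bool) \<Rightarrow> ('v, 'k::comm_ring_1) mpoly set
      \<Rightarrow> ('v, 'k) mpoly set" where
  "initial_ideal V lt I =
     genideal (poly_ring V) {Poly_Mapping.single (lead_monomial lt p) 1 |p. p \<in> I \<and> p \<noteq> 0}"


section \<open>The ideal \<open>J\<^sub>n\<close>\<close>

datatype var = X nat nat | Y nat

definition x_vars :: "nat \<Rightarrow> var set" where
  "x_vars n = {X i j |i j. 1 \<le> i \<and> i < j \<and> j \<le> n}"

definition y_vars :: "nat \<Rightarrow> var set" where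
  "y_vars n = {Y i |i. 1 \<le> i \<and> i \<le> n}"

definition S_vars :: "nat \<Rightarrow> var set" where
  "S_vars n = x_vars n \<union> y_vars n"

definition xv :: "nat \<Rightarrow> nat \<Rightarrow> (var, 'k::comm_ring_1) mpoly" where
  "xv i j = (if i < j then pvar (X i j) else if j < i then - pvar (X j i) else 0)"

definition yv :: "nat \<Rightarrow> (var, 'k::comm_ring_1) mpoly" where
  "yv i = pvar (Y i)"

definition Phi :: "nat \<Rightarrow> nat \<Rightarrow> nat \<Rightarrow> nat \<Rightarrow> (var, 'k::comm_ring_1) mpoly" where
  "Phi i j k l = xv i j * xv k l - xv i k * xv j l + xv i l * xv j k"

definition f_poly :: "nat \<Rightarrow> nat \<Rightarrow> (var, 'k::comm_ring_1) mpoly" where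
  "f_poly n i = (\<Sum>j=1..n. xv i j * yv j)"

definition J_ideal :: "nat \<Rightarrow> (var, 'k::comm_ring_1) mpoly set" where
  "J_ideal n = genideal (poly_ring (S_vars n))
     ({Phi i j k l |i j k l. 1 \<le> i \<and> i < j \<and> j < k \<and> k < l \<and> l \<le> n} \<union> {f_poly n i |i. 1 \<le> i \<and> i \<le> n})"


section \<open>The term order\<close>

definition deg_in :: "'v set \<Rightarrow> 'v monomial \<Rightarrow> nat" where
  "deg_in A m = (\<Sum>v\<in>A. Poly_Mapping.lookup m v)"

definition circular ::
    "'k::comm_ring_1 itself \<Rightarrow> nat \<Rightarrow> (var monomial \<Rightarrow> var monomial \<Rightarrow> bool) \<Rightarrow> bool" where
  "circular (_ :: 'k itself) n lt \<longleftrightarrow>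
     monomial_order (x_vars n) lt \<and>
     (\<forall>i j k l. 1 \<le> i \<and> i < j \<and> j < k \<and> k < l \<and> l \<le> n \<longrightarrow>
        lead_monomial lt (Phi i j k l :: (var, 'k) mpoly)
          = Poly_Mapping.single (X i k) 1 + Poly_Mapping.single (X j l) 1)"

definition compatible_iii :: "nat \<Rightarrow> (var monomial \<Rightarrow> var monomial \<Rightarrow> bool) \<Rightarrow> bool" where
  "compatible_iii n lt \<longleftrightarrow>
     (\<forall>a\<in>monomials (x_vars n). \<forall>b\<in>monomials (x_vars n).
        deg_in (x_vars n) a = deg_in (x_vars n) b \<and>
        Poly_Mapping.lookup a (X (n - 1) n) > Poly_Mapping.lookup b (X (n - 1) n)
        \<longrightarrow> lt a b)"

text \<open>Exponents of the \<open>y\<close>-variables, most significant variable first: \<open>y\<^sub>n, y\<^sub>1, y\<^sub>2, \<dots>, y\<^sub>n\<^sub>-\<^sub>1\<close>.\<close>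

definition y_exponents :: "nat \<Rightarrow> var monomial \<Rightarrow> nat list" where
  "y_exponents n m = map (\<lambda>i. Poly_Mapping.lookup m (Y i)) (n # [1..<n])"

definition x_part :: "nat \<Rightarrow> var monomial \<Rightarrow> var monomial" where
  "x_part n m = (\<Sum>v\<in>x_vars n. Poly_Mapping.single v (Poly_Mapping.lookup m v))"

definition term_less ::
    "nat \<Rightarrow> (var monomial \<Rightarrow> var monomial \<Rightarrow> bool) \<Rightarrow> var monomial \<Rightarrow> var monomial \<Rightarrow> bool" where
  "term_less n circ a b \<longleftrightarrow>
     (let d = deg_in (S_vars n);
          e = deg_in {Y i |i. 2 \<le> i \<and> i \<le> n - 1};
          u = (\<lambda>m. Poly_Mapping.lookup m (X (n - 1) n));
          ys = y_exponents n
      in d a < d b \<or> d a = d b \<and>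
          (e a > e b \<or> e a = e b \<and>
            (u a > u b \<or> u a = u b \<and>
              ((ys a, ys b) \<in> lexord less_than \<or> ys a = ys b \<and>
                circ (x_part n a) (x_part n b)))))"


section \<open>Simplicial complexes\<close>

text \<open>A simplicial complex is represented by its set of faces.\<close>

definition stanley_reisner_ideal :: "'v set \<Rightarrow> 'v set set \<Rightarrow> ('v, 'k::comm_ring_1) mpoly set" where
  "stanley_reisner_ideal V K = genideal (poly_ring V) {\<Prod>v\<in>p. pvar v |p. p \<subseteq> V \<and> p \<notin> K}"

definition sc_join :: "'v set set \<Rightarrow> 'v set set \<Rightarrow> 'v set set" where
  "sc_join K L = {g \<union> h |g h. g \<in> K \<and> h \<in> L}"

text \<open>Stellar subdivision of \<open>K\<close> at the face \<open>g\<^sub>0\<close>, with new vertex \<open>v\<close>.\<close>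

definition stellar :: "'v \<Rightarrow> 'v set \<Rightarrow> 'v set set \<Rightarrow> 'v set set" where
  "stellar v g\<^sub>0 K =
     {g \<in> K. \<not> g\<^sub>0 \<subseteq> g} \<union> {insert v g |g. g \<in> K \<and> \<not> g\<^sub>0 \<subseteq> g \<and> g\<^sub>0 \<union> g \<in> K}"

definition simplex :: "nat \<Rightarrow> nat set set" where
  "simplex m = Pow {0..m}"

text \<open>
  One type for all vertices involved, so that the joins below are joins of complexes on disjoint
  vertex sets; the vertices of the simplex are embedded by \<open>Simp\<close>. The diagonal joining
  \<open>i\<close> and \<open>j\<close> is \<open>Diag i j\<close> with \<open>i < j\<close>.
\<close>

datatype vertex = Diag nat nat | W1 | W2 | NewV | Simp nat

definition diagonals :: "nat \<Rightarrow> vertex set" where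
  "diagonals n = {Diag i j |i j. 1 \<le> i \<and> i < j \<and> j \<le> n \<and> j \<noteq> i + 1 \<and> \<not> (i = 1 \<and> j = n)}"

fun crosses :: "vertex \<Rightarrow> vertex \<Rightarrow> bool" where
  "crosses (Diag i j) (Diag k l) \<longleftrightarrow> i < k \<and> k < j \<and> j < l \<or> k < i \<and> i < l \<and> l < j"
| "crosses _ _ \<longleftrightarrow> False"

definition A_complex :: "nat \<Rightarrow> vertex set set" where
  "A_complex n = {g. g \<subseteq> diagonals n \<and> (\<forall>d\<in>g. \<forall>d'\<in>g. \<not> crosses d d')}"

definition S0_complex :: "vertex set set" where
  "S0_complex = {{}, {W1}, {W2}}"

definition K_complex :: "nat \<Rightarrow> vertex set set" where
  "K_complex n = stellar NewV {Diag 1 (n - 1), W1} (sc_join (A_complex n) S0_complex)"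

text \<open>The complex \<open>\<K>\<^sub>n * \<Delta>\<^sub>2\<^sub>n\<^sub>-\<^sub>4\<close> and its vertex set.\<close>

definition KD_complex :: "nat \<Rightarrow> vertex set set" where
  "KD_complex n = sc_join (K_complex n) ((`) Simp ` simplex (2 * n - 4))"

definition KD_vertices :: "nat \<Rightarrow> vertex set" where
  "KD_vertices n = diagonals n \<union> {W1, W2, NewV} \<union> Simp ` {0..2 * n - 4}"

text \<open>
  The correspondence between vertices and variables of \<open>S\<^sub>n\<close>. The vertices \<open>0, \<dots>, 2n - 4\<close> of the
  simplex correspond, in this order, to \<open>x\<^sub>1\<^sub>2, x\<^sub>2\<^sub>3, \<dots>, x\<^sub>(\<^sub>n\<^sub>-\<^sub>1\<^sub>)\<^sub>n, y\<^sub>2, \<dots>, y\<^sub>n\<^sub>-\<^sub>1\<close>.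
\<close>

fun vertex_var :: "nat \<Rightarrow> vertex \<Rightarrow> var" where
  "vertex_var n (Diag i j) = X i j"
| "vertex_var n W1 = Y 1"
| "vertex_var n NewV = Y n"
| "vertex_var n W2 = X 1 n"
| "vertex_var n (Simp k) =
     (if k < n - 1 then X (k + 1) (k + 2) else Y (k - (n - 1) + 2))"

lemma bij_betw_vertex_var:
  assumes "n \<ge> 5"
  shows "bij_betw (vertex_var n) (KD_vertices n) (S_vars n)"
proof (rule bij_betw_imageI)
  show "inj_on (vertex_var n) (KD_vertices n)"
  proof (rule inj_onI)
    fix a b
    assume "a \<in> KD_vertices n" "b \<in> KD_vertices n" "vertex_var n a = vertex_var n b"
    then show "a = b"
      using assms
      by (cases a; cases b) (auto simp: KD_vertices_def diagonals_def split: if_splits)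
  qed
  have "v \<in> vertex_var n ` KD_vertices n" if "v \<in> S_vars n" for v
  proof (cases v)
    case (X i j)
    with that have ij: "1 \<le> i" "i < j" "j \<le> n"
      by (auto simp: S_vars_def x_vars_def y_vars_def)
    consider "i = 1 \<and> j = n" | "j = i + 1" | "\<not> (i = 1 \<and> j = n)" "j \<noteq> i + 1"
      by blast
    then show ?thesis
    proof cases
      case 1
      then show ?thesis using X by (intro image_eqI[of _ _ W2]) (auto simp: KD_vertices_def)
    next
      case 2
      then show ?thesis using X ij
        by (intro image_eqI[of _ _ "Simp (i - 1)"]) (auto simp: KD_vertices_def)
    next
      case 3
      then show ?thesis using X ij
        by (intro image_eqI[of _ _ "Diag i j"]) (auto simp: KD_vertices_def diagonals_def)
    qed
  next
    case (Y i)
    with that have i: "1 \<le> i" "i \<le> n"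
      by (auto simp: S_vars_def x_vars_def y_vars_def)
    consider "i = 1" | "i = n" | "2 \<le> i" "i < n"
      using i by linarith
    then show ?thesis
    proof cases
      case 1
      then show ?thesis using Y by (intro image_eqI[of _ _ W1]) (auto simp: KD_vertices_def)
    next
      case 2
      then show ?thesis using Y by (intro image_eqI[of _ _ NewV]) (auto simp: KD_vertices_def)
    next
      case 3
      then show ?thesis using Y assms
        by (intro image_eqI[of _ _ "Simp (n - 1 + (i - 2))"]) (auto simp: KD_vertices_def)
    qed
  qed
  moreover have "vertex_var n v \<in> S_vars n" if "v \<in> KD_vertices n" for v
    using that assms
    by (cases v) (auto simp: KD_vertices_def diagonals_def S_vars_def x_vars_def y_vars_def)
  ultimately show "vertex_var n ` KD_vertices n = S_vars n"
    by blast
qed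

end

theory Submission
  imports Defs
begin

text \<open>
  The \<open>\<Phi>\<^sub>i\<^sub>j\<^sub>k\<^sub>l\<close> and \<open>f\<^sub>i\<close> have as leading monomials exactly the minimal non-faces, so it suffices that
  no nonzero element of \<open>J\<^sub>n\<close> is a combination of monomials divisible by none of these (standard
  monomials). Evaluate at a point of the variety over \<open>\<bbbK>[t]\<close>: \<open>x\<^sub>i\<^sub>j = a\<^sub>i b\<^sub>j - a\<^sub>j b\<^sub>i\<close> with \<open>y\<^sub>1, y\<^sub>n\<close> solved for in
  terms of the other \<open>y\<^sub>l\<close>, where the \<open>a\<^sub>i, b\<^sub>j, y\<^sub>l\<close> are powers of \<open>t\<close> whose exponents are powers of a large
  number \<open>N\<close>. The base-\<open>N\<close> digits of the degree of the value of a standard monomial record the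
  out-degrees and in-degrees of a noncrossing multigraph on the vertices of the \<open>n\<close>-gon, and such a
  multigraph is determined by its degrees, like a matching of parentheses. Hence distinct standard
  monomials have values of distinct degrees.
\<close>

section \<open>Monomial orders and normal forms\<close>

text \<open>Independence suffices because a leading monomial divisible by none of the listed ones
  would survive the reduction of its polynomial by them. For independence it is enough that J_n
  vanishes at one point adapted to the given polynomial. The exponents are arranged so that x_ij
  leads with a_i b_j, while y_1, y_n and the other y_l, with z_l the free parameters, lead with
  a_(n-1) b_n z_(n-1), a_1 b_(n-1) z_(n-1) and a_1 b_n z_l. So the y-variables count as edges too,
  namely (n-1,n), (1,n-1) and (1,n), and they share these edges with x-variables. Noncrossing
  encodes the leading monomials of the Phi_ijkl and the y_n x_in with 2 <= i <= n-2. What the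
  multigraph and the z-digits leave open are the exchanges y_1 x_1n <-> y_(n-1) x_(n-1)n, y_n x_1n
  <-> y_(n-1) x_1(n-1) and y_1 x_1(n-1) <-> y_n x_(n-1)n between terms of f_n, f_1 and f_(n-1).
  Their left-hand sides are exactly the other three leading monomials.\<close>

lemma ideal_poly_ring_closed:
  fixes I :: "('v, 'k::comm_ring_1) mpoly set"
  assumes "ideal I (poly_ring V)"
  shows ideal_poly_ring_keys: "p \<in> I \<Longrightarrow> Poly_Mapping.keys p \<subseteq> monomials V"
    and ideal_poly_ring_zero: "0 \<in> I"
    and ideal_poly_ring_add: "p \<in> I \<Longrightarrow> q \<in> I \<Longrightarrow> p + q \<in> I"
    and ideal_poly_ring_mult: "p \<in> I \<Longrightarrow> Poly_Mapping.keys q \<subseteq> monomials V \<Longrightarrow> q * p \<in> I"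
proof -
  interpret ideal I "poly_ring V :: ('v, 'k) mpoly ring" by fact
  show "p \<in> I \<Longrightarrow> Poly_Mapping.keys p \<subseteq> monomials V"
    using Icarr[of p] by (auto simp: poly_ring_def)
  show "0 \<in> I" using additive_subgroup.zero_closed[OF is_additive_subgroup] by (simp add: poly_ring_def)
  show "p \<in> I \<Longrightarrow> q \<in> I \<Longrightarrow> p + q \<in> I"
    using additive_subgroup.a_closed[OF is_additive_subgroup, of p q] by (simp add: poly_ring_def)
  show "p \<in> I \<Longrightarrow> Poly_Mapping.keys q \<subseteq> monomials V \<Longrightarrow> q * p \<in> I"
    using I_l_closed[of p q] by (simp add: poly_ring_def)
qed

lemma zero_in_monomials [simp]: "0 \<in> monomials V"
  by (simp add: monomials_def)

lemma add_in_monomials_iff [simp]: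
  "a + b \<in> monomials V \<longleftrightarrow> a \<in> monomials V \<and> b \<in> monomials V"
  by (auto simp: monomials_def in_keys_iff lookup_add subset_iff)

lemma single_in_monomials [simp]:
  "c \<noteq> 0 \<Longrightarrow> Poly_Mapping.single v c \<in> monomials V \<longleftrightarrow> v \<in> V"
  by (simp add: monomials_def)

lemma ideal_poly_ring_diff:
  fixes I :: "('v, 'k::comm_ring_1) mpoly set"
  assumes "ideal I (poly_ring V)" "p \<in> I" "q \<in> I"
  shows "p - q \<in> I"
proof -
  have "Poly_Mapping.keys (- 1 :: ('v, 'k) mpoly) \<subseteq> monomials V"
    by (auto simp: in_keys_iff lookup_one when_def split: if_splits)
  then have "p + (- 1) * q \<in> I"
    using assms by (intro ideal_poly_ring_add[of _ V] ideal_poly_ring_mult[of _ V]) auto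
  then show ?thesis by simp
qed

lemma ideal_poly_ring_sum:
  fixes I :: "('v, 'k::comm_ring_1) mpoly set"
  assumes "ideal I (poly_ring V)" "\<And>a. a \<in> A \<Longrightarrow> f a \<in> I"
  shows "sum f A \<in> I"
  using assms(2)
  by (induction A rule: infinite_finite_induct)
     (auto intro: ideal_poly_ring_zero[OF assms(1)] ideal_poly_ring_add[OF assms(1)])

lemma lookup_single_mult:
  fixes g :: "('v, 'k::comm_semiring_1) mpoly"
  shows "Poly_Mapping.lookup (Poly_Mapping.single w c * g) (w + k) = c * Poly_Mapping.lookup g k"
  by (simp add: lookup_mult lookup_single when_mult)

lemma mpoly_sum_singles:
  "p = (\<Sum>m\<in>Poly_Mapping.keys p. Poly_Mapping.single m (Poly_Mapping.lookup p m))"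
  by (rule poly_mapping_eqI)
     (auto simp: lookup_sum lookup_single when_def sum.delta' in_keys_iff)

lemma keys_sum_subset:
  "Poly_Mapping.keys (sum f A) \<subseteq> (\<Union>a\<in>A. Poly_Mapping.keys (f a))"
proof (induction A rule: infinite_finite_induct)
  case (insert a A)
  then show ?case using keys_add[of "f a" "sum f A"] by auto
qed auto

lemma keys_const_mult_subset:
  fixes p :: "('v, 'k::comm_semiring_1) mpoly"
  shows "Poly_Mapping.keys (Poly_Mapping.single 0 c * p) \<subseteq> Poly_Mapping.keys p"
  using keys_mult[of "Poly_Mapping.single 0 c" p] by (auto split: if_splits)

lemma
  assumes "monomial_order V lt"
  shows monomial_order_irrefl: "a \<in> monomials V \<Longrightarrow> \<not> lt a a"
    and monomial_order_trans:
      "lt a b \<Longrightarrow> lt b c \<Longrightarrow> a \<in> monomials V \<Longrightarrow> b \<in> monomials V \<Longrightarrow> c \<in> monomials V \<Longrightarrow> lt a c"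
    and monomial_order_total:
      "a \<noteq> b \<Longrightarrow> a \<in> monomials V \<Longrightarrow> b \<in> monomials V \<Longrightarrow> lt a b \<or> lt b a"
    and monomial_order_add:
      "lt a b \<Longrightarrow> a \<in> monomials V \<Longrightarrow> b \<in> monomials V \<Longrightarrow> c \<in> monomials V \<Longrightarrow> lt (a + c) (b + c)"
  using assms unfolding monomial_order_def by blast+

lemma monomial_order_greatest:
  assumes "monomial_order V lt" "finite A" "A \<noteq> {}" "A \<subseteq> monomials V"
  shows "\<exists>m\<in>A. \<forall>m'\<in>A. m' \<noteq> m \<longrightarrow> lt m' m"
  using assms(2-)
proof (induction rule: finite_ne_induct)
  case (insert x F)
  then obtain m where m: "m \<in> F" "\<forall>m'\<in>F. m' \<noteq> m \<longrightarrow> lt m' m" by auto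
  have xm: "x \<in> monomials V" "m \<in> monomials V" "x \<noteq> m"
    using insert m(1) by auto
  consider "lt x m" | "lt m x"
    using monomial_order_total[OF assms(1) xm(3,1,2)] by blast
  then show ?case
  proof cases
    case 1
    then show ?thesis using m by blast
  next
    case 2
    have "lt m' x" if "m' \<in> F" for m'
    proof (cases "m' = m")
      case False
      then have "lt m' m" using m(2) that by blast
      then show ?thesis
        using monomial_order_trans[OF assms(1) _ 2 _ xm(2,1)] that insert.prems by auto
    qed (use 2 in simp)
    then show ?thesis by blast
  qed
qed auto

lemma lead_monomial_eqI:
  assumes "monomial_order V lt" "Poly_Mapping.keys p \<subseteq> monomials V"
    and "m \<in> Poly_Mapping.keys p"
    and "\<And>m'. m' \<in> Poly_Mapping.keys p \<Longrightarrow> m' \<noteq> m \<Longrightarrow> lt m' m"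
  shows "lead_monomial lt p = m"
  unfolding lead_monomial_def
proof (rule the_equality)
  fix m'
  assume *: "m' \<in> Poly_Mapping.keys p \<and> (\<forall>m''\<in>Poly_Mapping.keys p. m'' \<noteq> m' \<longrightarrow> lt m'' m')"
  show "m' = m"
  proof (rule ccontr)
    assume "m' \<noteq> m"
    then have "lt m m'" "lt m' m" using assms * by auto
    moreover have "m \<in> monomials V" "m' \<in> monomials V" using assms(2,3) * by auto
    ultimately show False
      using monomial_order_trans[OF assms(1), of m m' m] monomial_order_irrefl[OF assms(1)] by blast
  qed
qed (use assms(3,4) in blast)

lemma
  assumes "monomial_order V lt" "Poly_Mapping.keys p \<subseteq> monomials V" "p \<noteq> 0"
  shows lead_monomial_in_keys: "lead_monomial lt p \<in> Poly_Mapping.keys p"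
    and lead_monomial_greatest:
      "m \<in> Poly_Mapping.keys p \<Longrightarrow> m \<noteq> lead_monomial lt p \<Longrightarrow> lt m (lead_monomial lt p)"
proof -
  have "Poly_Mapping.keys p \<noteq> {}"
    using assms(3) by (auto intro: poly_mapping_eqI simp: in_keys_iff)
  then obtain m0 where m0: "m0 \<in> Poly_Mapping.keys p"
      "\<forall>m'\<in>Poly_Mapping.keys p. m' \<noteq> m0 \<longrightarrow> lt m' m0"
    using monomial_order_greatest[OF assms(1) finite_keys _ assms(2)] by blast
  then have "lead_monomial lt p = m0"
    by (intro lead_monomial_eqI[OF assms(1,2)]) blast+
  then show "lead_monomial lt p \<in> Poly_Mapping.keys p"
    and "m \<in> Poly_Mapping.keys p \<Longrightarrow> m \<noteq> lead_monomial lt p \<Longrightarrow> lt m (lead_monomial lt p)"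
    using m0 by auto
qed

section \<open>Reduction modulo an ideal by prescribed leading monomials\<close>

definition divisible_by :: "'v monomial set \<Rightarrow> 'v monomial \<Rightarrow> bool" where
  "divisible_by M m \<longleftrightarrow> (\<exists>a\<in>M. \<exists>w. m = a + w)"

text \<open>A divisible \<open>m\<close> is the leading monomial of a multiple of some
  \<open>g\<close> in \<open>I\<close>, hence congruent to a combination of smaller monomials, which
  are reduced recursively. The recursion runs on the number of monomials below \<open>m\<close>,
  finite by \<open>fin\<close>. The bound on the keys of \<open>r\<close> and the last clause, that
  a standard monomial is its own normal form, serve to follow a leading coefficient through the
  reduction.\<close>

lemma normal_form_exists:
  fixes I :: "('v, 'k::field) mpoly set"
  assumes ord: "monomial_order V lt"
    and fin: "\<And>a. a \<in> monomials V \<Longrightarrow> finite {b \<in> monomials V. lt b a}"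
    and I: "ideal I (poly_ring V)"
    and lead: "\<And>a. a \<in> M \<Longrightarrow> \<exists>g\<in>I. g \<noteq> 0 \<and> lead_monomial lt g = a"
    and "m \<in> monomials V"
  shows "\<exists>r. Poly_Mapping.keys r \<subseteq> {b \<in> monomials V. b = m \<or> lt b m}
    \<and> (\<forall>b\<in>Poly_Mapping.keys r. \<not> divisible_by M b)
    \<and> Poly_Mapping.single m 1 - r \<in> I
    \<and> (\<not> divisible_by M m \<longrightarrow> r = Poly_Mapping.single m 1)"
  using \<open>m \<in> monomials V\<close>
proof (induction "card {b \<in> monomials V. lt b m}" arbitrary: m rule: less_induct)
  case less
  note lt_trans = monomial_order_trans[OF ord] and irr = monomial_order_irrefl[OF ord]
  show ?case
  proof (cases "divisible_by M m")
    case False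
    then show ?thesis
      using less.prems by (intro exI[of _ "Poly_Mapping.single m 1"]) (auto intro: ideal_poly_ring_zero[OF I])
  next
    case True
    then obtain a w where aw: "a \<in> M" "m = a + w" by (auto simp: divisible_by_def)
    with less.prems have w: "w \<in> monomials V" and a: "a \<in> monomials V" by auto
    obtain g where g: "g \<in> I" "g \<noteq> 0" "lead_monomial lt g = a" using lead[OF aw(1)] by auto
    note gk = ideal_poly_ring_keys[OF I g(1)]
    define c where "c = Poly_Mapping.lookup g a"
    have c: "c \<noteq> 0"
      using lead_monomial_in_keys[OF ord gk g(2)] g(3) by (auto simp: c_def in_keys_iff)
    \<comment> \<open>The multiple of \<open>g\<close> with leading monomial \<open>m\<close>,
      normalised to leading coefficient 1.\<close>
    define h where "h = Poly_Mapping.single w (1 / c) * g"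
    have h: "h \<in> I"
      unfolding h_def by (rule ideal_poly_ring_mult[OF I g(1)]) (use w c in auto)
    have hm: "Poly_Mapping.lookup h m = 1"
      using lookup_single_mult[of w "1 / c" g a] c aw(2) by (simp add: h_def c_def add.commute)
    define A where "A = Poly_Mapping.keys h - {m}"
    have A: "k \<in> monomials V \<and> lt k m" if "k \<in> A" for k
    proof -
      from that obtain b where b: "b \<in> Poly_Mapping.keys g" "k = w + b" "k \<noteq> m"
        using keys_mult[of "Poly_Mapping.single w (1 / c)" g] by (auto simp: A_def h_def split: if_splits)
      have "lt b a" using lead_monomial_greatest[OF ord gk g(2) b(1)] b g(3) aw by (auto simp: add.commute)
      then have "lt (b + w) (a + w)" using monomial_order_add[OF ord _ _ a w] b(1) gk by blast
      then show ?thesis using b w gk aw by (auto simp: add.commute)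
    qed
    have "\<exists>r. Poly_Mapping.keys r \<subseteq> {b \<in> monomials V. b = k \<or> lt b k}
      \<and> (\<forall>b\<in>Poly_Mapping.keys r. \<not> divisible_by M b) \<and> Poly_Mapping.single k 1 - r \<in> I" if "k \<in> A" for k
    proof -
      have "{b \<in> monomials V. lt b k} \<subset> {b \<in> monomials V. lt b m}"
        using A[OF that] lt_trans[of _ k m] irr[of k] less.prems by blast
      then show ?thesis
        using less.hyps[of k] A[OF that] psubset_card_mono[OF fin[OF less.prems]] by blast
    qed
    then have "\<exists>r. \<forall>k\<in>A. Poly_Mapping.keys (r k) \<subseteq> {b \<in> monomials V. b = k \<or> lt b k}
      \<and> (\<forall>b\<in>Poly_Mapping.keys (r k). \<not> divisible_by M b) \<and> Poly_Mapping.single k 1 - r k \<in> I"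
      by (intro bchoice ballI)
    then obtain r where r: "\<And>k. k \<in> A \<Longrightarrow> Poly_Mapping.keys (r k) \<subseteq> {b \<in> monomials V. b = k \<or> lt b k}"
      "\<And>k b. k \<in> A \<Longrightarrow> b \<in> Poly_Mapping.keys (r k) \<Longrightarrow> \<not> divisible_by M b"
      "\<And>k. k \<in> A \<Longrightarrow> Poly_Mapping.single k 1 - r k \<in> I" by blast
    \<comment> \<open>Modulo \<open>I\<close> the monomial \<open>m\<close> equals minus the tail of
      \<open>h\<close>; \<open>s\<close> is this negated tail with every monomial replaced by its
      normal form.\<close>
    define s where "s = (\<Sum>k\<in>A. Poly_Mapping.single 0 (- Poly_Mapping.lookup h k) * r k)"
    have hsum: "h = Poly_Mapping.single m 1 + (\<Sum>k\<in>A. Poly_Mapping.single k (Poly_Mapping.lookup h k))"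
    proof -
      have "m \<in> Poly_Mapping.keys h" using hm by (simp add: in_keys_iff)
      then have "(\<Sum>k\<in>Poly_Mapping.keys h. Poly_Mapping.single k (Poly_Mapping.lookup h k))
          = Poly_Mapping.single m 1 + (\<Sum>k\<in>A. Poly_Mapping.single k (Poly_Mapping.lookup h k))"
        using sum.remove[OF finite_keys, of m h "\<lambda>k. Poly_Mapping.single k (Poly_Mapping.lookup h k)"] hm
        by (simp add: A_def)
      then show ?thesis by (rule trans[OF mpoly_sum_singles])
    qed
    have "h - (\<Sum>k\<in>A. Poly_Mapping.single 0 (Poly_Mapping.lookup h k) * (Poly_Mapping.single k 1 - r k))
        = Poly_Mapping.single m 1 - s"
      by (subst hsum)
         (simp add: s_def right_diff_distrib sum_subtractf mult_single single_uminus sum_negf)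
    moreover have "h - (\<Sum>k\<in>A. Poly_Mapping.single 0 (Poly_Mapping.lookup h k) * (Poly_Mapping.single k 1 - r k)) \<in> I"
      by (intro ideal_poly_ring_diff[OF I] h ideal_poly_ring_sum[OF I] ideal_poly_ring_mult[OF I] r(3))
         auto
    moreover have "\<exists>k\<in>A. b \<in> Poly_Mapping.keys (r k)" if "b \<in> Poly_Mapping.keys s" for b
      using that keys_sum_subset keys_const_mult_subset unfolding s_def by fast
    then have "Poly_Mapping.keys s \<subseteq> {b \<in> monomials V. b = m \<or> lt b m}"
      and "\<forall>b\<in>Poly_Mapping.keys s. \<not> divisible_by M b"
      using r(1,2) A lt_trans[OF _ _ _ _ less.prems] by blast+
    ultimately show ?thesis using True by auto
  qed
qed

text \<open>If the leading monomial \<open>m0\<close> of \<open>p\<close> were standard, replacing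
  every monomial of \<open>p\<close> by its normal form would give an element \<open>q\<close> of
  \<open>I\<close> made of standard monomials. Normal forms of smaller monomials cannot contain
  \<open>m0\<close>, so \<open>q\<close> keeps the leading coefficient of \<open>p\<close> and is
  nonzero, against \<open>indep\<close>.\<close>

lemma lead_monomial_divisible_by:
  fixes I :: "('v, 'k::field) mpoly set"
  assumes ord: "monomial_order V lt"
    and fin: "\<And>a. a \<in> monomials V \<Longrightarrow> finite {b \<in> monomials V. lt b a}"
    and I: "ideal I (poly_ring V)"
    and lead: "\<And>a. a \<in> M \<Longrightarrow> \<exists>g\<in>I. g \<noteq> 0 \<and> lead_monomial lt g = a"
    and indep: "\<And>q. q \<in> I \<Longrightarrow> \<forall>m\<in>Poly_Mapping.keys q. \<not> divisible_by M m \<Longrightarrow> q = 0"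
    and p: "p \<in> I" "p \<noteq> 0"
  shows "divisible_by M (lead_monomial lt p)"
proof (rule ccontr)
  define m0 where "m0 = lead_monomial lt p"
  assume "\<not> divisible_by M (lead_monomial lt p)"
  note pk = ideal_poly_ring_keys[OF I p(1)]
  have "\<exists>r. \<forall>m\<in>Poly_Mapping.keys p. Poly_Mapping.keys (r m) \<subseteq> {b \<in> monomials V. b = m \<or> lt b m}
    \<and> (\<forall>b\<in>Poly_Mapping.keys (r m). \<not> divisible_by M b) \<and> Poly_Mapping.single m 1 - r m \<in> I
    \<and> (\<not> divisible_by M m \<longrightarrow> r m = Poly_Mapping.single m 1)"
    using normal_form_exists[OF ord fin I lead] pk by (intro bchoice ballI) blast
  then obtain r where r: "\<And>m. m \<in> Poly_Mapping.keys p \<Longrightarrow> Poly_Mapping.keys (r m) \<subseteq> {b \<in> monomials V. b = m \<or> lt b m}"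
    "\<And>m b. m \<in> Poly_Mapping.keys p \<Longrightarrow> b \<in> Poly_Mapping.keys (r m) \<Longrightarrow> \<not> divisible_by M b"
    "\<And>m. m \<in> Poly_Mapping.keys p \<Longrightarrow> Poly_Mapping.single m 1 - r m \<in> I"
    "\<And>m. m \<in> Poly_Mapping.keys p \<Longrightarrow> \<not> divisible_by M m \<Longrightarrow> r m = Poly_Mapping.single m 1" by blast
  define q where "q = (\<Sum>m\<in>Poly_Mapping.keys p. Poly_Mapping.single 0 (Poly_Mapping.lookup p m) * r m)"
  have "q = p - (\<Sum>m\<in>Poly_Mapping.keys p.
      Poly_Mapping.single 0 (Poly_Mapping.lookup p m) * (Poly_Mapping.single m 1 - r m))"
    by (subst mpoly_sum_singles[of p])
       (simp add: q_def right_diff_distrib sum_subtractf mult_single)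
  also have "\<dots> \<in> I"
    by (intro ideal_poly_ring_diff[OF I] p ideal_poly_ring_sum[OF I] ideal_poly_ring_mult[OF I] r(3)) auto
  finally have "q \<in> I" .
  moreover have "\<forall>b\<in>Poly_Mapping.keys q. \<not> divisible_by M b"
    using r(2) keys_sum_subset keys_const_mult_subset unfolding q_def by fast
  ultimately have "q = 0" by (rule indep)
  have m0: "m0 \<in> Poly_Mapping.keys p"
    unfolding m0_def by (rule lead_monomial_in_keys[OF ord pk p(2)])
  have other: "Poly_Mapping.lookup (r m) m0 = 0" if "m \<in> Poly_Mapping.keys p" "m \<noteq> m0" for m
  proof (rule ccontr)
    assume "Poly_Mapping.lookup (r m) m0 \<noteq> 0"
    then have "lt m0 m" using r(1)[OF that(1)] that(2) by (auto simp: in_keys_iff)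
    moreover have "lt m m0"
      using lead_monomial_greatest[OF ord pk p(2)] that by (auto simp: m0_def)
    ultimately show False
      using that m0 pk monomial_order_trans[OF ord, of m m0 m] monomial_order_irrefl[OF ord] by blast
  qed
  have "Poly_Mapping.lookup q m0 = (\<Sum>m\<in>Poly_Mapping.keys p. if m = m0 then Poly_Mapping.lookup p m0 else 0)"
    unfolding q_def lookup_sum
  proof (rule sum.cong[OF refl])
    fix m assume m: "m \<in> Poly_Mapping.keys p"
    have "Poly_Mapping.lookup (Poly_Mapping.single 0 (Poly_Mapping.lookup p m) * r m) m0
        = Poly_Mapping.lookup p m * Poly_Mapping.lookup (r m) m0"
      using lookup_single_mult[of 0 "Poly_Mapping.lookup p m" "r m" m0] by simp
    then show "Poly_Mapping.lookup (Poly_Mapping.single 0 (Poly_Mapping.lookup p m) * r m) m0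
        = (if m = m0 then Poly_Mapping.lookup p m0 else 0)"
      using other[OF m] r(4)[OF m] \<open>\<not> divisible_by M (lead_monomial lt p)\<close> by (auto simp: m0_def)
  qed
  then have "Poly_Mapping.lookup p m0 = 0" using \<open>q = 0\<close> m0 by simp
  then show False using m0 by (simp add: in_keys_iff)
qed

section \<open>Evaluation at univariate polynomials\<close>

definition monom_eval :: "('v \<Rightarrow> 'k::comm_semiring_1 poly) \<Rightarrow> 'v monomial \<Rightarrow> 'k poly" where
  "monom_eval h m = (\<Prod>v\<in>Poly_Mapping.keys m. h v ^ Poly_Mapping.lookup m v)"

definition mpoly_eval :: "('v \<Rightarrow> 'k::comm_ring_1 poly) \<Rightarrow> ('v, 'k) mpoly \<Rightarrow> 'k poly" where
  "mpoly_eval h p = (\<Sum>m\<in>Poly_Mapping.keys p. smult (Poly_Mapping.lookup p m) (monom_eval h m))"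

lemma monom_eval_superset:
  assumes "finite A" "Poly_Mapping.keys m \<subseteq> A"
  shows "monom_eval h m = (\<Prod>v\<in>A. h v ^ Poly_Mapping.lookup m v)"
  unfolding monom_eval_def
  by (rule prod.mono_neutral_left) (use assms in \<open>auto simp: in_keys_iff\<close>)

lemma monom_eval_add: "monom_eval h (a + b) = monom_eval h a * monom_eval h b"
proof -
  let ?A = "Poly_Mapping.keys a \<union> Poly_Mapping.keys b"
  have "monom_eval h (a + b) = (\<Prod>v\<in>?A. h v ^ Poly_Mapping.lookup (a + b) v)"
    by (rule monom_eval_superset) (use keys_add[of a b] in auto)
  also have "\<dots> = (\<Prod>v\<in>?A. h v ^ Poly_Mapping.lookup a v) * (\<Prod>v\<in>?A. h v ^ Poly_Mapping.lookup b v)"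
    by (simp add: lookup_add power_add prod.distrib)
  also have "\<dots> = monom_eval h a * monom_eval h b"
    by (subst (1 2) monom_eval_superset[of ?A]) auto
  finally show ?thesis .
qed

lemma mpoly_eval_superset:
  assumes "finite A" "Poly_Mapping.keys p \<subseteq> A"
  shows "mpoly_eval h p = (\<Sum>m\<in>A. smult (Poly_Mapping.lookup p m) (monom_eval h m))"
  unfolding mpoly_eval_def
  by (rule sum.mono_neutral_left) (use assms in \<open>auto simp: in_keys_iff\<close>)

lemma mpoly_eval_zero [simp]: "mpoly_eval h 0 = 0"
  by (simp add: mpoly_eval_def)

lemma mpoly_eval_single [simp]: "mpoly_eval h (Poly_Mapping.single m c) = smult c (monom_eval h m)"
  by (simp add: mpoly_eval_def)

lemma mpoly_eval_add [simp]: "mpoly_eval h (p + q) = mpoly_eval h p + mpoly_eval h q"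
proof -
  let ?A = "Poly_Mapping.keys p \<union> Poly_Mapping.keys q"
  have "mpoly_eval h (p + q) = (\<Sum>m\<in>?A. smult (Poly_Mapping.lookup (p + q) m) (monom_eval h m))"
    by (rule mpoly_eval_superset) (use keys_add[of p q] in auto)
  also have "\<dots> = (\<Sum>m\<in>?A. smult (Poly_Mapping.lookup p m) (monom_eval h m))
      + (\<Sum>m\<in>?A. smult (Poly_Mapping.lookup q m) (monom_eval h m))"
    by (simp add: lookup_add smult_add_left sum.distrib)
  also have "\<dots> = mpoly_eval h p + mpoly_eval h q"
    by (subst (1 2) mpoly_eval_superset[of ?A]) auto
  finally show ?thesis .
qed

lemma mpoly_eval_sum: "mpoly_eval h (sum f A) = (\<Sum>a\<in>A. mpoly_eval h (f a))"
  by (induction A rule: infinite_finite_induct) auto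

lemma mpoly_eval_uminus [simp]: "mpoly_eval h (- p) = - mpoly_eval h p"
  using mpoly_eval_add[of h p "- p"] by (simp add: eq_neg_iff_add_eq_0 add.commute)

lemma mpoly_eval_diff [simp]: "mpoly_eval h (p - q) = mpoly_eval h p - mpoly_eval h q"
  using mpoly_eval_add[of h p "- q"] by simp

lemma mpoly_eval_mult [simp]: "mpoly_eval h (p * q) = mpoly_eval h p * mpoly_eval h q"
proof -
  have "p * q = (\<Sum>a\<in>Poly_Mapping.keys p. \<Sum>b\<in>Poly_Mapping.keys q.
      Poly_Mapping.single (a + b) (Poly_Mapping.lookup p a * Poly_Mapping.lookup q b))"
    by (subst mpoly_sum_singles[of p], subst mpoly_sum_singles[of q])
       (simp add: sum_product mult_single)
  then have "mpoly_eval h (p * q) = (\<Sum>a\<in>Poly_Mapping.keys p. \<Sum>b\<in>Poly_Mapping.keys q.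
      smult (Poly_Mapping.lookup p a * Poly_Mapping.lookup q b) (monom_eval h a * monom_eval h b))"
    by (simp add: mpoly_eval_sum monom_eval_add)
  then show ?thesis
    by (simp add: mpoly_eval_def sum_product ac_simps)
qed

lemma mpoly_eval_pvar [simp]: "mpoly_eval h (pvar v) = h v"
  by (simp add: pvar_def monom_eval_def)

text \<open>By minimality of \<open>genideal\<close>, this reduces vanishing on J_n to vanishing on
  its generators.\<close>

lemma ideal_mpoly_eval_kernel:
  fixes h :: "'v \<Rightarrow> 'k::comm_ring_1 poly"
  shows "ideal {p. Poly_Mapping.keys p \<subseteq> monomials V \<and> mpoly_eval h p = 0} (poly_ring V)"
    (is "ideal ?I ?R")
proof -
  interpret cring ?R by (rule cring_poly_ring)
  have mult: "Poly_Mapping.keys (p * q) \<subseteq> monomials V"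
    if "Poly_Mapping.keys p \<subseteq> monomials V" "Poly_Mapping.keys q \<subseteq> monomials V" for p q :: "('v, 'k) mpoly"
    using m_closed[of p q] that by (auto simp: poly_ring_def)
  have keys_minus: "Poly_Mapping.keys (- p) = Poly_Mapping.keys p" for p :: "('v, 'k) mpoly"
    by (auto simp: in_keys_iff)
  have minus: "\<ominus>\<^bsub>?R\<^esub> p = - p" if "p \<in> carrier ?R" for p
    by (rule minus_equality) (use that keys_minus[of p] in \<open>auto simp: poly_ring_def\<close>)
  have sub: "subgroup ?I (add_monoid ?R)"
  proof
    show "?I \<subseteq> carrier (add_monoid ?R)" by (auto simp: poly_ring_def)
    show "p \<otimes>\<^bsub>add_monoid ?R\<^esub> q \<in> ?I" if "p \<in> ?I" "q \<in> ?I" for p q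
      using that keys_add[of p q] by (auto simp: poly_ring_def)
    show "\<one>\<^bsub>add_monoid ?R\<^esub> \<in> ?I" by (simp add: poly_ring_def)
    show "inv\<^bsub>add_monoid ?R\<^esub> p \<in> ?I" if "p \<in> ?I" for p
    proof -
      have "inv\<^bsub>add_monoid ?R\<^esub> p = - p"
        using minus[of p] that unfolding a_inv_def by (simp add: poly_ring_def)
      then show ?thesis using that keys_minus[of p] by simp
    qed
  qed
  show ?thesis
    by (rule idealI[OF ring_axioms sub]) (use mult in \<open>auto simp: poly_ring_def\<close>)
qed

text \<open>The summand of largest degree has no partner to cancel with, so its leading coefficient
  is a coefficient of the sum.\<close>

lemma sum_neq_0_distinct_degrees:
  fixes f :: "'a \<Rightarrow> 'k::comm_monoid_add poly"
  assumes "finite A" "A \<noteq> {}" "\<And>a. a \<in> A \<Longrightarrow> f a \<noteq> 0" "inj_on (\<lambda>a. degree (f a)) A"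
  shows "sum f A \<noteq> 0"
proof -
  have "Max ((\<lambda>a. degree (f a)) ` A) \<in> (\<lambda>a. degree (f a)) ` A"
    using assms(1,2) by (intro Max_in) auto
  then obtain a where a: "a \<in> A" "degree (f a) = Max ((\<lambda>a. degree (f a)) ` A)" by auto
  have "degree (f b) < degree (f a)" if "b \<in> A" "b \<noteq> a" for b
  proof -
    have "degree (f b) \<le> degree (f a)" using a that assms(1) by simp
    moreover have "degree (f b) \<noteq> degree (f a)" using inj_onD[OF assms(4), of b a] that a(1) by auto
    ultimately show ?thesis by simp
  qed
  then have "coeff (f b) (degree (f a)) = 0" if "b \<in> A - {a}" for b
    using that by (intro coeff_eq_0) auto
  then have "coeff (sum f A) (degree (f a)) = lead_coeff (f a)"
    using sum.remove[OF assms(1) a(1), of "\<lambda>b. coeff (f b) (degree (f a))"] by (simp add: coeff_sum)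
  then show ?thesis using assms(3)[OF a(1)] by auto
qed

lemma mpoly_eval_eq_0_imp:
  fixes q :: "('v, 'k::idom) mpoly"
  assumes "mpoly_eval h q = 0"
    and "\<And>m. m \<in> Poly_Mapping.keys q \<Longrightarrow> monom_eval h m \<noteq> 0"
    and "inj_on (\<lambda>m. degree (monom_eval h m)) (Poly_Mapping.keys q)"
  shows "q = 0"
proof (rule ccontr)
  assume "q \<noteq> 0"
  then have "Poly_Mapping.keys q \<noteq> {}"
    by (auto intro: poly_mapping_eqI simp: in_keys_iff)
  then have "mpoly_eval h q \<noteq> 0"
    unfolding mpoly_eval_def using assms(2,3)
    by (intro sum_neq_0_distinct_degrees) (auto simp: in_keys_iff inj_on_def)
  with assms(1) show False by simp
qed

lemma monom_eval_neq_0: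
  fixes h :: "'v \<Rightarrow> 'k::idom poly"
  assumes "\<And>v. v \<in> Poly_Mapping.keys m \<Longrightarrow> h v \<noteq> 0"
  shows "monom_eval h m \<noteq> 0"
  using assms by (simp add: monom_eval_def)

lemma degree_monom_eval:
  fixes h :: "'v \<Rightarrow> 'k::idom poly"
  assumes "finite A" "Poly_Mapping.keys m \<subseteq> A" "\<And>v. v \<in> A \<Longrightarrow> h v \<noteq> 0"
  shows "degree (monom_eval h m) = (\<Sum>v\<in>A. Poly_Mapping.lookup m v * degree (h v))"
  using assms
  by (simp add: monom_eval_superset[OF assms(1,2)] degree_prod_eq_sum_degree degree_power_eq)

section \<open>Digit expansions and noncrossing multigraphs\<close>

lemma digit_expansion_unique:
  fixes c d :: "nat \<Rightarrow> nat"
  assumes "\<And>k. k < n \<Longrightarrow> c k < N" "\<And>k. k < n \<Longrightarrow> d k < N"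
    and "(\<Sum>k<n. c k * N ^ k) = (\<Sum>k<n. d k * N ^ k)" "k < n"
  shows "c k = d k"
  using assms
proof (induction n arbitrary: c d k)
  case (Suc n)
  have split: "(\<Sum>k<Suc n. e k * N ^ k) = e 0 + N * (\<Sum>k<n. e (Suc k) * N ^ k)" for e :: "nat \<Rightarrow> nat"
    unfolding sum.lessThan_Suc_shift by (simp add: sum_distrib_left ac_simps)
  have N: "c 0 < N" "d 0 < N" using Suc.prems by auto
  have eq: "c 0 + N * (\<Sum>k<n. c (Suc k) * N ^ k) = d 0 + N * (\<Sum>k<n. d (Suc k) * N ^ k)"
    using Suc.prems(3) unfolding split .
  from arg_cong[OF eq, of "\<lambda>x. x mod N"] N have 0: "c 0 = d 0" by simp
  with eq N have "(\<Sum>k<n. c (Suc k) * N ^ k) = (\<Sum>k<n. d (Suc k) * N ^ k)" by auto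
  then have "c (Suc i) = d (Suc i)" if "i < n" for i
    using Suc.prems(1,2) that by (intro Suc.IH[of "\<lambda>k. c (Suc k)" "\<lambda>k. d (Suc k)"]) auto
  with 0 Suc.prems(4) show ?case by (cases k) auto
qed simp

text \<open>
  Multigraphs on the vertices \<open>\<le> n\<close> of a convex polygon: \<open>M i j\<close> is the multiplicity of the edge
  from \<open>i\<close> to \<open>j > i\<close>.
\<close>

definition noncrossing :: "nat \<Rightarrow> (nat \<Rightarrow> nat \<Rightarrow> nat) \<Rightarrow> bool" where
  "noncrossing n M \<longleftrightarrow> (\<forall>i j. M i j > 0 \<longrightarrow> i < j \<and> j \<le> n) \<and>
     (\<forall>i j k l. i < j \<longrightarrow> j < k \<longrightarrow> k < l \<longrightarrow> M i k = 0 \<or> M j l = 0)"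

lemma sum_nat_pos_imp:
  fixes f :: "'a \<Rightarrow> nat"
  assumes "(\<Sum>i\<in>A. f i) > 0"
  shows "\<exists>i\<in>A. f i > 0"
  using assms by (metis gr_zeroI less_irrefl sum.neutral)

lemma noncrossing_support: "noncrossing n M \<Longrightarrow> M i j > 0 \<Longrightarrow> i < j \<and> j \<le> n"
  by (simp add: noncrossing_def)

lemma noncrossing_no_cross:
  "noncrossing n M \<Longrightarrow> i < j \<Longrightarrow> j < k \<Longrightarrow> k < l \<Longrightarrow> M i k = 0 \<or> M j l = 0"
  unfolding noncrossing_def by presburger

lemma noncrossing_mono:
  assumes "noncrossing n M" "\<And>i j. M1 i j \<le> M i j"
  shows "noncrossing n M1"
  unfolding noncrossing_def
proof (intro conjI allI impI)
  show "i < j" "j \<le> n" if "M1 i j > 0" for i j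
    using noncrossing_support[OF assms(1), of i j] assms(2)[of i j] that by auto
  show "M1 i k = 0 \<or> M1 j l = 0" if "i < j" "j < k" "k < l" for i j k l
    using noncrossing_no_cross[OF assms(1) that] assms(2)[of i k] assms(2)[of j l] by auto
qed

text \<open>Take an edge from \<open>k\<close> to \<open>J\<close> and one from \<open>I\<close> to
  \<open>l\<close>. No edge ends before \<open>J\<close>, so \<open>l\<close> is at least
  \<open>J\<close>; no edge starts strictly between \<open>I\<close> and \<open>J\<close>, so
  \<open>k\<close> is at most \<open>I\<close>; and if both inequalities were strict, the two edges
  would cross. Apart from noncrossing, the hypotheses concern degrees only, so the same
  \<open>I\<close> and \<open>J\<close> work for every noncrossing multigraph with these
  degrees.\<close>

lemma noncrossing_innermost_edge:
  assumes M: "noncrossing n M"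
    and J: "(\<Sum>i\<le>n. M i J) > 0" "\<And>j. j < J \<Longrightarrow> (\<Sum>i\<le>n. M i j) = 0"
    and I: "I < J" "(\<Sum>j\<le>n. M I j) > 0" "\<And>i. I < i \<Longrightarrow> i < J \<Longrightarrow> (\<Sum>j\<le>n. M i j) = 0"
  shows "M I J > 0"
proof -
  have supp: "M i j > 0 \<Longrightarrow> i < j \<and> j \<le> n" for i j using noncrossing_support[OF M] .
  obtain k where k: "M k J > 0" using sum_nat_pos_imp[OF J(1)] by blast
  obtain l where l: "M I l > 0" using sum_nat_pos_imp[OF I(2)] by blast
  have "\<not> l < J"
    using J(2)[of l] l supp[OF l] by auto
  moreover have "\<not> (I < k)"
    using I(3)[of k] k supp[OF k] by auto
  moreover have "M k J = 0 \<or> M I l = 0" if "k < I" "J < l"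
    using noncrossing_no_cross[OF M, of k I J l] that I(1) by simp
  ultimately have "k = I \<or> l = J"
    using k l by (cases k I rule: linorder_cases; cases l J rule: linorder_cases) auto
  with k l show ?thesis by auto
qed

text \<open>
  As for matching parentheses, the innermost edge is forced: it joins the first vertex \<open>J\<close> at
  which some edge ends to the last vertex before \<open>J\<close> at which some edge starts.
\<close>

lemma noncrossing_unique:
  assumes "noncrossing n M" "noncrossing n M'"
    and "\<And>i. (\<Sum>j\<le>n. M i j) = (\<Sum>j\<le>n. M' i j)"
    and "\<And>j. (\<Sum>i\<le>n. M i j) = (\<Sum>i\<le>n. M' i j)"
  shows "M = M'"
  using assms
proof (induction "\<Sum>i\<le>n. \<Sum>j\<le>n. M i j" arbitrary: M M' rule: less_induct)
  case less
  note out_eq = less.prems(3) and in_eq = less.prems(4)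
  have supp: "M i j > 0 \<Longrightarrow> i < j \<and> j \<le> n" "M' i j > 0 \<Longrightarrow> i < j \<and> j \<le> n" for i j
    by (fact noncrossing_support[OF less.prems(1)] noncrossing_support[OF less.prems(2)])+
  show ?case
  proof (cases "\<exists>j. (\<Sum>i\<le>n. M i j) > 0")
    case False
    have "M i j = 0 \<and> M' i j = 0" for i j
    proof -
      have "(\<Sum>i\<le>n. M i j) = 0" using False by (meson gr_zeroI)
      moreover from this have "(\<Sum>i\<le>n. M' i j) = 0" by (simp only: in_eq)
      ultimately have "i \<le> n \<Longrightarrow> M i j = 0 \<and> M' i j = 0" by simp
      then show ?thesis using supp[of i j] by linarith
    qed
    then show ?thesis by (intro ext) auto
  next
    case True
    define J where "J = (LEAST j. (\<Sum>i\<le>n. M i j) > 0)"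
    have J: "(\<Sum>i\<le>n. M i J) > 0" using True unfolding J_def by (rule LeastI_ex)
    have J': "(\<Sum>i\<le>n. M i j) = 0" if "j < J" for j
      using not_less_Least[of j "\<lambda>j. (\<Sum>i\<le>n. M i j) > 0"] that unfolding J_def by blast
    obtain k where k: "k \<le> n" "M k J > 0" using sum_nat_pos_imp[OF J] by auto
    let ?P = "\<lambda>i. i < J \<and> (\<Sum>j\<le>n. M i j) > 0"
    \<comment> \<open>An edge ending at \<open>J\<close> starts before \<open>J\<close>, so the
      greatest such starting vertex exists.\<close>
    have Pk: "?P k"
      using supp(1)[OF k(2)] k member_le_sum[of J "{..n}" "M k"] by auto
    define I where "I = (GREATEST i. ?P i)"
    have I: "?P I" unfolding I_def by (rule GreatestI_nat[of ?P k J]) (use Pk in auto)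
    have I': "(\<Sum>j\<le>n. M i j) = 0" if "I < i" "i < J" for i
      using Greatest_le_nat[of ?P i J] that unfolding I_def by (meson gr0I leD less_imp_le)
    have pos: "M I J > 0"
      by (rule noncrossing_innermost_edge[OF less.prems(1) J J']) (use I I' in auto)
    have pos': "M' I J > 0"
      by (rule noncrossing_innermost_edge[OF less.prems(2)])
         (use J J' I I' in \<open>auto simp: out_eq in_eq\<close>)
    \<comment> \<open>One copy of the forced edge is removed from both multigraphs; their degrees
      still agree and the total number of edges drops.\<close>
    define e :: "nat \<Rightarrow> nat \<Rightarrow> nat" where "e i j = (if i = I \<and> j = J then 1 else 0)" for i j
    define M1 where "M1 i j = M i j - e i j" for i j
    define M1' where "M1' i j = M' i j - e i j" for i j
    have M: "M i j = M1 i j + e i j" and M': "M' i j = M1' i j + e i j" for i j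
      using pos pos' by (auto simp: M1_def M1'_def e_def)
    have "(\<Sum>i\<le>n. \<Sum>j\<le>n. e i j) > 0"
    proof -
      have "I \<le> n" "J \<le> n" using supp(1)[OF pos] by auto
      then have "e I J \<le> (\<Sum>j\<le>n. e I j)" "(\<Sum>j\<le>n. e I j) \<le> (\<Sum>i\<le>n. \<Sum>j\<le>n. e i j)"
        by (auto intro!: member_le_sum)
      then show ?thesis by (simp add: e_def)
    qed
    then have "(\<Sum>i\<le>n. \<Sum>j\<le>n. M1 i j) < (\<Sum>i\<le>n. \<Sum>j\<le>n. M i j)"
      by (simp add: M sum.distrib)
    moreover have "noncrossing n M1" "noncrossing n M1'"
      by (rule noncrossing_mono[OF less.prems(1)], simp add: M1_def)
         (rule noncrossing_mono[OF less.prems(2)], simp add: M1'_def)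
    moreover have "(\<Sum>j\<le>n. M1 i j) = (\<Sum>j\<le>n. M1' i j)" "(\<Sum>i\<le>n. M1 i j) = (\<Sum>i\<le>n. M1' i j)" for i j
      using out_eq[of i] in_eq[of j] by (simp_all add: M M' sum.distrib)
    ultimately have "M1 = M1'" by (intro less.hyps)
    then show ?thesis by (intro ext) (simp add: M M')
  qed
qed

section \<open>Leading pairs and standard monomials\<close>

text \<open>In order, these come from Phi_ijkl, f_n, f_(n-1), and f_i with i <= n-2. They are kept
  as pairs of variables rather than monomials so that they can be matched with non-faces having two
  elements.\<close>

inductive lead_pair :: "nat \<Rightarrow> var \<Rightarrow> var \<Rightarrow> bool" for n where
  cross: "1 \<le> i \<Longrightarrow> i < j \<Longrightarrow> j < k \<Longrightarrow> k < l \<Longrightarrow> l \<le> n \<Longrightarrow> lead_pair n (X i k) (X j l)"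
| y1_x1n: "lead_pair n (Y 1) (X 1 n)"
| y1_x1n': "lead_pair n (Y 1) (X 1 (n - 1))"
| yn_xin: "1 \<le> i \<Longrightarrow> i \<le> n - 2 \<Longrightarrow> lead_pair n (Y n) (X i n)"

definition pair_monomial :: "'v \<Rightarrow> 'v \<Rightarrow> 'v monomial" where
  "pair_monomial u v = Poly_Mapping.single u 1 + Poly_Mapping.single v 1"

definition lead_monomials :: "nat \<Rightarrow> var monomial set" where
  "lead_monomials n = {pair_monomial u v |u v. lead_pair n u v}"

lemma lead_pair_neq: "lead_pair n u v \<Longrightarrow> u \<noteq> v"
  by (auto elim: lead_pair.cases)

lemma pair_monomial_times:
  assumes "u \<noteq> v" "Poly_Mapping.lookup m u > 0" "Poly_Mapping.lookup m v > 0"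
  shows "\<exists>w. m = pair_monomial u v + w"
proof -
  have "m = pair_monomial u v + (m - pair_monomial u v)"
    by (rule poly_mapping_eqI)
       (use assms in \<open>auto simp: pair_monomial_def lookup_add lookup_minus lookup_single when_def\<close>)
  then show ?thesis ..
qed

lemma standard_lookup:
  assumes "\<not> divisible_by (lead_monomials n) m" "lead_pair n u v"
  shows "Poly_Mapping.lookup m u = 0 \<or> Poly_Mapping.lookup m v = 0"
proof (rule ccontr)
  assume "\<not> ?thesis"
  then obtain w where "m = pair_monomial u v + w"
    using pair_monomial_times[OF lead_pair_neq[OF assms(2)]] by auto
  with assms show False by (auto simp: divisible_by_def lead_monomials_def)
qed

lemma S_vars_iff:
  "X i j \<in> S_vars n \<longleftrightarrow> 1 \<le> i \<and> i < j \<and> j \<le> n" "Y i \<in> S_vars n \<longleftrightarrow> 1 \<le> i \<and> i \<le> n"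
  "X i j \<in> x_vars n \<longleftrightarrow> 1 \<le> i \<and> i < j \<and> j \<le> n" "Y i \<notin> x_vars n"
  by (auto simp: S_vars_def x_vars_def y_vars_def)

lemma finite_x_vars [simp]: "finite (x_vars n)"
proof (rule finite_subset)
  show "x_vars n \<subseteq> (\<lambda>(i, j). X i j) ` ({..n} \<times> {..n})" by (force simp: x_vars_def)
qed simp

lemma finite_S_vars [simp]: "finite (S_vars n)"
proof -
  have "y_vars n = Y ` {1..n}" by (auto simp: y_vars_def)
  then show ?thesis by (simp add: S_vars_def)
qed

lemma sum_S_vars:
  assumes "n \<ge> 2"
  shows "(\<Sum>v\<in>S_vars n. f v) = (\<Sum>v\<in>x_vars n. f v) + f (Y 1) + f (Y n) + (\<Sum>l=2..n-1. f (Y l))"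
proof -
  have "{1..n} = insert 1 (insert n {2..n-1})" using assms by auto
  then have y: "y_vars n = Y ` insert 1 (insert n {2..n-1})"
    by (auto simp: y_vars_def)
  have "(\<Sum>v\<in>S_vars n. f v) = (\<Sum>v\<in>x_vars n. f v) + (\<Sum>v\<in>y_vars n. f v)"
    unfolding S_vars_def
    by (rule sum.union_disjoint) (use finite_S_vars[of n] in \<open>auto simp: S_vars_def y_vars_def x_vars_def\<close>)
  also have "(\<Sum>v\<in>y_vars n. f v) = (\<Sum>l\<in>insert 1 (insert n {2..n-1}). f (Y l))"
    unfolding y by (subst sum.reindex) (auto simp: inj_on_def)
  also have "\<dots> = f (Y 1) + (f (Y n) + (\<Sum>l=2..n-1. f (Y l)))"
    using assms by simp
  finally show ?thesis by (simp add: ac_simps)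
qed


section \<open>A rank two point of the variety\<close>

text \<open>The Pluecker coordinates of the row space of a matrix with rows \<open>a\<close> and
  \<open>b\<close>; the Phi_ijkl are the three-term Pluecker relations between them.\<close>

definition minor2 :: "(nat \<Rightarrow> 'a::comm_ring_1) \<Rightarrow> (nat \<Rightarrow> 'a) \<Rightarrow> nat \<Rightarrow> nat \<Rightarrow> 'a" where
  "minor2 a b i j = a i * b j - a j * b i"

text \<open>
  A parametrisation of the locus \<open>x\<^sub>1\<^sub>n \<noteq> 0\<close>: the values of \<open>y\<^sub>1\<close> and \<open>y\<^sub>n\<close> are those forced by
  \<open>f\<^sub>n = f\<^sub>1 = 0\<close>, with all \<open>y\<close>-coordinates scaled by \<open>x\<^sub>1\<^sub>n\<close> to clear denominators.
\<close>

fun point :: "nat \<Rightarrow> (nat \<Rightarrow> 'a::comm_ring_1) \<Rightarrow> (nat \<Rightarrow> 'a) \<Rightarrow> (nat \<Rightarrow> 'a) \<Rightarrow> var \<Rightarrow> 'a" where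
  "point n a b z (X i j) = minor2 a b i j"
| "point n a b z (Y j) =
     (if j = 1 then - (\<Sum>l=2..n-1. minor2 a b l n * z l)
      else if j = n then - (\<Sum>l=2..n-1. minor2 a b 1 l * z l)
      else minor2 a b 1 n * z j)"

lemma mpoly_eval_xv [simp]: "mpoly_eval (point n a b z) (xv i j) = minor2 a b i j"
  by (auto simp: xv_def minor2_def)

lemma mpoly_eval_yv [simp]: "mpoly_eval (point n a b z) (yv j) = point n a b z (Y j)"
  by (simp add: yv_def)

lemma mpoly_eval_Phi: "mpoly_eval (point n a b z) (Phi i j k l) = 0"
  by (simp add: Phi_def minor2_def algebra_simps)

lemma mpoly_eval_f_poly:
  assumes "n \<ge> 2"
  shows "mpoly_eval (point n a b z) (f_poly n i) = 0"
proof -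
  let ?p = "\<lambda>j. minor2 a b i j * point n a b z (Y j)"
  have "{1..n} = insert 1 (insert n {2..n-1})" using assms by auto
  then have "mpoly_eval (point n a b z) (f_poly n i) = ?p 1 + (?p n + (\<Sum>l=2..n-1. ?p l))"
    using assms by (simp add: f_poly_def mpoly_eval_sum del: point.simps)
  also have "(\<Sum>l=2..n-1. ?p l) = (\<Sum>l=2..n-1. minor2 a b i l * (minor2 a b 1 n * z l))"
    by (rule sum.cong) auto
  \<comment> \<open>Collected by \<open>z l\<close>, each coefficient is, up to sign, the Pluecker
    relation for the indices i, 1, l, n, which holds for every order of the indices and also when
    some coincide. So every summand vanishes by itself.\<close>
  also have "?p 1 + (?p n + \<dots>) = (\<Sum>l=2..n-1.
      - (minor2 a b i 1 * (minor2 a b l n * z l)) + (- (minor2 a b i n * (minor2 a b 1 l * z l))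
        + minor2 a b i l * (minor2 a b 1 n * z l)))"
    using assms by (simp add: sum_subtractf sum_negf sum_distrib_left)
  also have "\<dots> = 0"
    by (rule sum.neutral) (auto simp: minor2_def algebra_simps)
  finally show ?thesis .
qed

section \<open>The generators as elements of the polynomial ring, and vanishing of J_n at the
  point\<close>

lemma
  fixes p q :: "('v, 'k::comm_ring_1) mpoly"
  assumes "Poly_Mapping.keys p \<subseteq> monomials V" "Poly_Mapping.keys q \<subseteq> monomials V"
  shows poly_ring_keys_mult: "Poly_Mapping.keys (p * q) \<subseteq> monomials V"
    and poly_ring_keys_add: "Poly_Mapping.keys (p + q) \<subseteq> monomials V"
    and poly_ring_keys_diff: "Poly_Mapping.keys (p - q) \<subseteq> monomials V"
  using cring.cring_simprules(1,5)[OF cring_poly_ring[of V], of p q] assms keys_diff[of p q]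
  by (auto simp: poly_ring_def)

lemma keys_xv: "1 \<le> i \<Longrightarrow> i \<le> n \<Longrightarrow> 1 \<le> j \<Longrightarrow> j \<le> n \<Longrightarrow>
    Poly_Mapping.keys (xv i j :: (var, 'k::comm_ring_1) mpoly) \<subseteq> monomials (S_vars n)"
  by (auto simp: xv_def pvar_def S_vars_iff in_keys_iff lookup_single when_def split: if_splits)

lemma keys_yv: "1 \<le> i \<Longrightarrow> i \<le> n \<Longrightarrow>
    Poly_Mapping.keys (yv i :: (var, 'k::comm_ring_1) mpoly) \<subseteq> monomials (S_vars n)"
  by (simp add: yv_def pvar_def S_vars_iff)

lemma keys_Phi:
  assumes "1 \<le> i" "i < j" "j < k" "k < l" "l \<le> n"
  shows "Poly_Mapping.keys (Phi i j k l :: (var, 'k::comm_ring_1) mpoly) \<subseteq> monomials (S_vars n)"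
  unfolding Phi_def
  by (intro poly_ring_keys_add poly_ring_keys_diff poly_ring_keys_mult keys_xv) (use assms in auto)

lemma keys_f_poly:
  assumes "1 \<le> i" "i \<le> n"
  shows "Poly_Mapping.keys (f_poly n i :: (var, 'k::comm_ring_1) mpoly) \<subseteq> monomials (S_vars n)"
proof -
  have "Poly_Mapping.keys (xv i j * yv j :: (var, 'k) mpoly) \<subseteq> monomials (S_vars n)" if "j \<in> {1..n}" for j
    by (intro poly_ring_keys_mult keys_xv keys_yv) (use assms that in auto)
  then show ?thesis unfolding f_poly_def using keys_sum_subset by fast
qed

lemma J_ideal_generators:
  "{Phi i j k l |i j k l. 1 \<le> i \<and> i < j \<and> j < k \<and> k < l \<and> l \<le> n} \<union> {f_poly n i |i. 1 \<le> i \<and> i \<le> n}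
    \<subseteq> carrier (poly_ring (S_vars n) :: (var, 'k::comm_ring_1) mpoly ring)"
  using keys_Phi keys_f_poly by (fastforce simp: poly_ring_def)

lemma ideal_J_ideal: "ideal (J_ideal n :: (var, 'k::comm_ring_1) mpoly set) (poly_ring (S_vars n))"
  unfolding J_ideal_def
  by (rule ring.genideal_ideal[OF cring.axioms(1)[OF cring_poly_ring] J_ideal_generators])

lemma Phi_in_J_ideal:
  assumes "1 \<le> i" "i < j" "j < k" "k < l" "l \<le> n"
  shows "(Phi i j k l :: (var, 'k::comm_ring_1) mpoly) \<in> J_ideal n"
  unfolding J_ideal_def
  using assms ring.genideal_self[OF cring.axioms(1)[OF cring_poly_ring] J_ideal_generators] by blast

lemma f_poly_in_J_ideal:
  assumes "1 \<le> i" "i \<le> n"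
  shows "(f_poly n i :: (var, 'k::comm_ring_1) mpoly) \<in> J_ideal n"
  unfolding J_ideal_def
  using assms ring.genideal_self[OF cring.axioms(1)[OF cring_poly_ring] J_ideal_generators] by blast

lemma mpoly_eval_J_ideal:
  fixes p :: "(var, 'k::comm_ring_1) mpoly"
  assumes "n \<ge> 2" "p \<in> J_ideal n"
  shows "mpoly_eval (point n a b z) p = 0"
proof -
  define G :: "(var, 'k) mpoly set" where
    "G = {Phi i j k l |i j k l. 1 \<le> i \<and> i < j \<and> j < k \<and> k < l \<and> l \<le> n} \<union> {f_poly n i |i. 1 \<le> i \<and> i \<le> n}"
  have "G \<subseteq> {p. Poly_Mapping.keys p \<subseteq> monomials (S_vars n)}"
    using J_ideal_generators[of n, where 'k = 'k] by (simp add: poly_ring_def G_def)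
  moreover have "mpoly_eval (point n a b z) q = 0" if "q \<in> G" for q
    using that mpoly_eval_f_poly[OF assms(1), of a b z] by (auto simp: mpoly_eval_Phi G_def)
  ultimately have "G \<subseteq> {p. Poly_Mapping.keys p \<subseteq> monomials (S_vars n) \<and> mpoly_eval (point n a b z) p = 0}"
    by blast
  then have "J_ideal n \<subseteq> {p. Poly_Mapping.keys p \<subseteq> monomials (S_vars n) \<and> mpoly_eval (point n a b z) p = 0}"
    unfolding J_ideal_def G_def[symmetric]
    by (intro ring.genideal_minimal[OF cring.axioms(1)[OF cring_poly_ring] ideal_mpoly_eval_kernel])
  with assms(2) show ?thesis by blast
qed

section \<open>Linear independence of the standard monomials\<close>

abbreviation (input) tpow :: "nat \<Rightarrow> 'k::idom poly" where
  "tpow e \<equiv> Polynomial.monom 1 e"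

text \<open>The digit positions form three disjoint blocks: b_j uses 1 to n, a_i uses n+1 to 2n, and
  z_l uses 2n+2 to 3n-1. Degrees of a_i decrease and those of b_j increase, so a_i b_j beats a_j b_i
  for i < j. The largest of the z_l is z_(n-1), which selects the last summand in the values of y_1
  and y_n.\<close>

definition generic_point :: "nat \<Rightarrow> nat \<Rightarrow> var \<Rightarrow> 'k::idom poly" where
  "generic_point n N = point n (\<lambda>i. tpow (N ^ (2 * n + 1 - i))) (\<lambda>j. tpow (N ^ j)) (\<lambda>l. tpow (N ^ (2 * n + l)))"

text \<open>
  The edge which the leading term of the value of a variable contributes to the multigraph
  recorded by the leading term of the value of a monomial, and the base-\<open>N\<close> digits of its degree.
\<close>

fun edge_of :: "nat \<Rightarrow> var \<Rightarrow> nat \<times> nat" where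
  "edge_of n (X i j) = (i, j)"
| "edge_of n (Y l) = (if l = 1 then (n - 1, n) else if l = n then (1, n - 1) else (1, n))"

fun y_digits :: "nat \<Rightarrow> var \<Rightarrow> nat set" where
  "y_digits n (X i j) = {}"
| "y_digits n (Y l) = (if l = 1 \<or> l = n then {3 * n - 1} else {2 * n + l})"

definition digits :: "nat \<Rightarrow> var \<Rightarrow> nat set" where
  "digits n v = {2 * n + 1 - fst (edge_of n v), snd (edge_of n v)} \<union> y_digits n v"

lemma degree_diff_eq_left:
  fixes p q :: "'k::idom poly"
  assumes "degree q < degree p"
  shows "degree (p - q) = degree p"
  using degree_add_eq_left[of "- q" p] assms by simp

lemma degree_sum_eq:
  fixes f :: "'a \<Rightarrow> 'k::idom poly"
  assumes "finite A" "a \<in> A" "\<And>b. b \<in> A \<Longrightarrow> b \<noteq> a \<Longrightarrow> degree (f b) < degree (f a)" "f a \<noteq> 0"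
  shows "degree (sum f A) = degree (f a)" "sum f A \<noteq> 0"
proof -
  have s: "sum f A = f a + sum f (A - {a})" by (rule sum.remove[OF assms(1,2)])
  have "degree (sum f A) = degree (f a) \<and> sum f A \<noteq> 0"
  \<comment> \<open>Bounding the degree of the remaining sum requires a positive bound. Any second
    summand provides it, whereas a single summand may be constant.\<close>
  proof (cases "A - {a} = {}")
    case True
    then show ?thesis using assms(4) s by (simp only: True sum.empty) simp
  next
    case False
    then obtain b where "b \<in> A" "b \<noteq> a" by auto
    then have pos: "0 < degree (f a)" using assms(3)[of b] by simp
    have "degree (sum f (A - {a})) < degree (f a)"
      by (rule degree_sum_less) (use assms(3) pos in auto)
    then have "degree (sum f A) = degree (f a)"
      unfolding s by (rule degree_add_eq_left)
    with pos show ?thesis by auto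
  qed
  then show "degree (sum f A) = degree (f a)" "sum f A \<noteq> 0" by auto
qed

lemma minor2_tpow:
  fixes a b :: "nat \<Rightarrow> nat"
  assumes "a j < a i" "b i < b j"
  shows "degree (minor2 (\<lambda>i. tpow (a i) :: 'k::idom poly) (\<lambda>i. tpow (b i)) i j) = a i + b j"
    and "minor2 (\<lambda>i. tpow (a i) :: 'k::idom poly) (\<lambda>i. tpow (b i)) i j \<noteq> 0"
proof -
  have "degree (tpow (a i + b j) - tpow (a j + b i) :: 'k poly) = a i + b j"
    using assms by (subst degree_diff_eq_left) (simp_all add: degree_monom_eq)
  then show *: "degree (minor2 (\<lambda>i. tpow (a i) :: 'k poly) (\<lambda>i. tpow (b i)) i j) = a i + b j"
    by (simp add: minor2_def mult_monom)
  show "minor2 (\<lambda>i. tpow (a i) :: 'k poly) (\<lambda>i. tpow (b i)) i j \<noteq> 0"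
    using * assms by (metis degree_0 add_is_0 not_less_zero)
qed

lemma generic_point:
  assumes n: "n \<ge> 5" and N: "N \<ge> 2" and v: "v \<in> S_vars n"
  shows generic_point_neq_0: "(generic_point n N v :: 'k::idom poly) \<noteq> 0"
    and degree_generic_point: "degree (generic_point n N v :: 'k poly) = (\<Sum>k\<in>digits n v. N ^ k)"
proof -
  define a where "a i = N ^ (2 * n + 1 - i)" for i
  define b where "b i = N ^ i" for i
  define z where "z l = N ^ (2 * n + l)" for l
  let ?m = "minor2 (\<lambda>i. tpow (a i) :: 'k poly) (\<lambda>i. tpow (b i))"
  have gp: "generic_point n N = point n (\<lambda>i. tpow (a i) :: 'k poly) (\<lambda>i. tpow (b i)) (\<lambda>l. tpow (z l))"
    by (simp add: generic_point_def a_def b_def z_def)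
  have a: "a j < a i" if "i < j" "j \<le> n" for i j
    using that N by (auto simp: a_def intro!: power_strict_increasing)
  have b: "b i < b j" if "i < j" for i j
    using that N by (auto simp: b_def intro!: power_strict_increasing)
  have z: "z i < z j" if "i < j" for i j
    using that N by (auto simp: z_def intro!: power_strict_increasing)
  \<comment> \<open>In the sum for y_1 the factor a_l favours small l and z_l favours large l. The
    factor z_(n-1) wins since its exponent N^(3n-1) is at least twice N^(3n-2), which bounds all
    competing exponents. In the sum for y_n both b_l and z_l increase with l, so no such estimate
    arises.\<close>
  have az: "a i + z i < a (n - 1) + z (n - 1)" if "1 \<le> i" "i < n - 1" for i
  proof -
    have "a i \<le> N ^ (3 * n - 2)" "z i \<le> N ^ (3 * n - 2)"
      using that N n by (auto simp: a_def z_def intro!: power_increasing)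
    then have "a i + z i \<le> 2 * N ^ (3 * n - 2)" by simp
    also have "\<dots> \<le> N * N ^ (3 * n - 2)" using N by simp
    also have "\<dots> = z (n - 1)"
    proof -
      have "2 * n + (n - 1) = Suc (3 * n - 2)" using n by simp
      then show ?thesis by (simp only: z_def power_Suc)
    qed
    also have "z (n - 1) < a (n - 1) + z (n - 1)" using N by (simp add: a_def)
    finally show ?thesis .
  qed
  have m: "degree (?m i j) = a i + b j" "?m i j \<noteq> 0" if "i < j" "j \<le> n" for i j
    using minor2_tpow[of a j i b] a b that by auto
  have mz: "degree (?m i j * tpow (z l)) = a i + b j + z l" "?m i j * tpow (z l) \<noteq> 0"
    if "i < j" "j \<le> n" for i j l
    using m[OF that] by (auto simp: degree_mult_eq degree_monom_eq)
  have goal: "(generic_point n N v :: 'k poly) \<noteq> 0 \<and>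
      degree (generic_point n N v :: 'k poly) = (\<Sum>k\<in>digits n v. N ^ k)"
  proof (cases v)
    case (X i j)
    with v have ij: "1 \<le> i" "i < j" "j \<le> n" by (auto simp: S_vars_iff)
    then show ?thesis
      using m[OF ij(2,3)] X by (auto simp: gp digits_def a_def b_def)
  next
    case (Y l)
    with v have l: "1 \<le> l" "l \<le> n" by (auto simp: S_vars_iff)
    consider "l = 1" | "l = n" | "1 < l" "l < n" using l by linarith
    then show ?thesis
    proof cases
      case 1
      let ?f = "\<lambda>i. ?m i n * tpow (z i)"
      let ?s = "\<Sum>i=2..n-1. ?f i"
      have "degree (?f i) < degree (?f (n - 1))" if "i \<in> {2..n-1}" "i \<noteq> n - 1" for i
      proof -
        have "1 \<le> i" "i < n - 1" "i < n" "n - 1 < n" using that n by auto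
        then show ?thesis using az[of i] by (simp add: mz)
      qed
      moreover have "n - 1 \<in> {2..n-1}" "?f (n - 1) \<noteq> 0" using n by (auto simp: m(2))
      ultimately have "degree ?s = degree (?f (n - 1))" "?s \<noteq> 0"
        using degree_sum_eq[of "{2..n-1}" "n - 1" ?f] by blast+
      then have "?s \<noteq> 0" "degree ?s = a (n - 1) + b n + z (n - 1)"
        using n by (auto simp: mz)
      moreover have "digits n v = {n + 2, n, 3 * n - 1}" using Y 1 n by (auto simp: digits_def)
      ultimately show ?thesis using n Y 1 by (auto simp: gp a_def b_def z_def)
    next
      case 2
      let ?f = "\<lambda>i. ?m 1 i * tpow (z i)"
      let ?s = "\<Sum>i=2..n-1. ?f i"
      have "degree (?f i) < degree (?f (n - 1))" if "i \<in> {2..n-1}" "i \<noteq> n - 1" for i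
      proof -
        have "1 < i" "i \<le> n" "i < n - 1" "1 < n - 1" "n - 1 \<le> n" using that n by auto
        then show ?thesis using b[of i "n - 1"] z[of i "n - 1"] by (simp add: mz)
      qed
      moreover have "n - 1 \<in> {2..n-1}" "?f (n - 1) \<noteq> 0" using n by (auto simp: m(2))
      ultimately have "degree ?s = degree (?f (n - 1))" "?s \<noteq> 0"
        using degree_sum_eq[of "{2..n-1}" "n - 1" ?f] by blast+
      then have "?s \<noteq> 0" "degree ?s = a 1 + b (n - 1) + z (n - 1)"
        using n by (auto simp: mz)
      moreover have "digits n v = {2 * n, n - 1, 3 * n - 1}" using Y 2 n by (auto simp: digits_def)
      \<comment> \<open>Summing over the set \<open>digits n v\<close> gives three powers of
        \<open>N\<close> only if the three digits are distinct.\<close>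
      moreover have "2 * n \<noteq> n - 1" "2 * n \<noteq> 3 * n - 1" "n - 1 \<noteq> 3 * n - 1" using n by auto
      ultimately show ?thesis using n Y 2 by (auto simp: gp a_def b_def z_def)
    next
      case 3
      then have "digits n v = {2 * n, n, 2 * n + l}" using Y by (auto simp: digits_def)
      then show ?thesis using n Y 3 mz[of 1 n l] by (auto simp: gp a_def b_def z_def)
    qed
  qed
  then show "(generic_point n N v :: 'k poly) \<noteq> 0"
    and "degree (generic_point n N v :: 'k poly) = (\<Sum>k\<in>digits n v. N ^ k)" by auto
qed

text \<open>The coefficient of N^k in the degree of the value of \<open>m\<close>, before any
  carrying; it is a genuine base-\<open>N\<close> digit once \<open>N\<close> exceeds all these
  counts.\<close>

definition digit_count :: "nat \<Rightarrow> var monomial \<Rightarrow> nat \<Rightarrow> nat" where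
  "digit_count n m k = (\<Sum>v\<in>S_vars n. if k \<in> digits n v then Poly_Mapping.lookup m v else 0)"

lemma digits_subset:
  assumes "n \<ge> 5" "v \<in> S_vars n"
  shows "digits n v \<subseteq> {..<3 * n}"
  using assms by (cases v) (auto simp: digits_def S_vars_iff)

lemma degree_monom_eval_generic_point:
  assumes "n \<ge> 5" "N \<ge> 2" "m \<in> monomials (S_vars n)"
  shows "degree (monom_eval (generic_point n N :: var \<Rightarrow> 'k::idom poly) m)
    = (\<Sum>k<3 * n. digit_count n m k * N ^ k)"
proof -
  have "degree (monom_eval (generic_point n N :: var \<Rightarrow> 'k poly) m)
      = (\<Sum>v\<in>S_vars n. Poly_Mapping.lookup m v * degree (generic_point n N v :: 'k poly))"
    using assms by (intro degree_monom_eval generic_point_neq_0) (auto simp: monomials_def)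
  also have "\<dots> = (\<Sum>v\<in>S_vars n. \<Sum>k<3 * n. if k \<in> digits n v then Poly_Mapping.lookup m v * N ^ k else 0)"
  proof (rule sum.cong[OF refl])
    fix v assume v: "v \<in> S_vars n"
    have "{..<3 * n} \<inter> digits n v = digits n v" using digits_subset[OF assms(1) v] by blast
    then show "Poly_Mapping.lookup m v * degree (generic_point n N v :: 'k poly)
        = (\<Sum>k<3 * n. if k \<in> digits n v then Poly_Mapping.lookup m v * N ^ k else 0)"
      by (simp add: degree_generic_point[OF assms(1,2) v] sum_distrib_left flip: sum.inter_restrict)
  qed
  also have "\<dots> = (\<Sum>k<3 * n. \<Sum>v\<in>S_vars n. if k \<in> digits n v then Poly_Mapping.lookup m v * N ^ k else 0)"
    by (rule sum.swap)
  also have "\<dots> = (\<Sum>k<3 * n. digit_count n m k * N ^ k)"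
    by (auto simp: digit_count_def sum_distrib_right intro!: sum.cong)
  finally show ?thesis .
qed

definition edge_mult :: "nat \<Rightarrow> var monomial \<Rightarrow> nat \<Rightarrow> nat \<Rightarrow> nat" where
  "edge_mult n m i j = (\<Sum>v\<in>S_vars n. if edge_of n v = (i, j) then Poly_Mapping.lookup m v else 0)"

lemma edge_of_bounds:
  assumes "n \<ge> 5" "v \<in> S_vars n"
  shows "1 \<le> fst (edge_of n v)" "fst (edge_of n v) < snd (edge_of n v)" "snd (edge_of n v) \<le> n"
  using assms by (cases v; auto simp: S_vars_iff)+

lemma edge_mult_eq:
  assumes "n \<ge> 5"
  shows "edge_mult n m i j = (if 1 \<le> i \<and> i < j \<and> j \<le> n then Poly_Mapping.lookup m (X i j) else 0)
    + (if (i, j) = (n - 1, n) then Poly_Mapping.lookup m (Y 1) else 0)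
    + (if (i, j) = (1, n - 1) then Poly_Mapping.lookup m (Y n) else 0)
    + (if (i, j) = (1, n) then \<Sum>l=2..n-1. Poly_Mapping.lookup m (Y l) else 0)"
proof -
  let ?f = "\<lambda>v. if edge_of n v = (i, j) then Poly_Mapping.lookup m v else 0"
  have "(\<Sum>v\<in>x_vars n. ?f v) = (\<Sum>v\<in>x_vars n. if v = X i j then Poly_Mapping.lookup m (X i j) else 0)"
    by (rule sum.cong) (auto simp: x_vars_def)
  also have "\<dots> = (if 1 \<le> i \<and> i < j \<and> j \<le> n then Poly_Mapping.lookup m (X i j) else 0)"
    by (simp add: S_vars_iff)
  finally have x: "(\<Sum>v\<in>x_vars n. ?f v) = (if 1 \<le> i \<and> i < j \<and> j \<le> n then Poly_Mapping.lookup m (X i j) else 0)" .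
  have if_out: "(\<Sum>l=2..n-1. if P then g l else 0) = (if P then \<Sum>l=2..n-1. g l else 0)"
    for P and g :: "nat \<Rightarrow> nat" by simp
  have "(\<Sum>l=2..n-1. ?f (Y l)) = (\<Sum>l=2..n-1. if (i, j) = (1, n) then Poly_Mapping.lookup m (Y l) else 0)"
    by (rule sum.cong) auto
  also have "\<dots> = (if (i, j) = (1, n) then \<Sum>l=2..n-1. Poly_Mapping.lookup m (Y l) else 0)"
    by (rule if_out)
  finally have y: "(\<Sum>l=2..n-1. ?f (Y l))
      = (if (i, j) = (1, n) then \<Sum>l=2..n-1. Poly_Mapping.lookup m (Y l) else 0)" .
  have n2: "n \<ge> 2" using assms by simp
  have "?f (Y 1) = (if (i, j) = (n - 1, n) then Poly_Mapping.lookup m (Y 1) else 0)"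
    "?f (Y n) = (if (i, j) = (1, n - 1) then Poly_Mapping.lookup m (Y n) else 0)"
    using assms by auto
  then show ?thesis
    unfolding edge_mult_def sum_S_vars[OF n2] x y by (simp only:)
qed

text \<open>Positions n+1 to 2n are used by tails of edges only: heads use 1 to n and the y-digits
  lie above 2n. So the count at position 2n+1-i counts exactly the edges starting at
  \<open>i\<close>.\<close>

lemma out_degree_edge_mult:
  assumes "n \<ge> 5" "1 \<le> i" "i \<le> n"
  shows "(\<Sum>j\<le>n. edge_mult n m i j) = digit_count n m (2 * n + 1 - i)"
proof -
  have "(\<Sum>j\<le>n. edge_mult n m i j) = (\<Sum>v\<in>S_vars n. \<Sum>j\<le>n. if edge_of n v = (i, j) then Poly_Mapping.lookup m v else 0)"
    unfolding edge_mult_def by (rule sum.swap)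
  also have "\<dots> = digit_count n m (2 * n + 1 - i)"
    unfolding digit_count_def
  proof (rule sum.cong[OF refl])
    fix v assume v: "v \<in> S_vars n"
    have "(\<Sum>j\<le>n. if edge_of n v = (i, j) then Poly_Mapping.lookup m v else 0)
        = (\<Sum>j\<le>n. if j = snd (edge_of n v) then (if fst (edge_of n v) = i then Poly_Mapping.lookup m v else 0) else 0)"
      by (rule sum.cong) auto
    also have "\<dots> = (if fst (edge_of n v) = i then Poly_Mapping.lookup m v else 0)"
      using edge_of_bounds[OF assms(1) v] by simp
    also have "fst (edge_of n v) = i \<longleftrightarrow> 2 * n + 1 - i \<in> digits n v"
    proof -
      have "2 * n + 1 - i \<notin> y_digits n v"
        using v assms by (cases v) (auto simp: S_vars_iff)
      then show ?thesis
        using edge_of_bounds[OF assms(1) v] assms by (auto simp: digits_def)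
    qed
    finally show "(\<Sum>j\<le>n. if edge_of n v = (i, j) then Poly_Mapping.lookup m v else 0)
        = (if 2 * n + 1 - i \<in> digits n v then Poly_Mapping.lookup m v else 0)" .
  qed
  finally show ?thesis .
qed

lemma in_degree_edge_mult:
  assumes "n \<ge> 5" "1 \<le> j" "j \<le> n"
  shows "(\<Sum>i\<le>n. edge_mult n m i j) = digit_count n m j"
proof -
  have "(\<Sum>i\<le>n. edge_mult n m i j) = (\<Sum>v\<in>S_vars n. \<Sum>i\<le>n. if edge_of n v = (i, j) then Poly_Mapping.lookup m v else 0)"
    unfolding edge_mult_def by (rule sum.swap)
  also have "\<dots> = digit_count n m j"
    unfolding digit_count_def
  proof (rule sum.cong[OF refl])
    fix v assume v: "v \<in> S_vars n"
    have "(\<Sum>i\<le>n. if edge_of n v = (i, j) then Poly_Mapping.lookup m v else 0)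
        = (\<Sum>i\<le>n. if i = fst (edge_of n v) then (if snd (edge_of n v) = j then Poly_Mapping.lookup m v else 0) else 0)"
      by (rule sum.cong) auto
    also have "\<dots> = (if snd (edge_of n v) = j then Poly_Mapping.lookup m v else 0)"
      using edge_of_bounds[OF assms(1) v] by simp
    also have "snd (edge_of n v) = j \<longleftrightarrow> j \<in> digits n v"
    proof -
      have "j \<notin> y_digits n v"
        using v assms by (cases v) (auto simp: S_vars_iff)
      then show ?thesis
        using edge_of_bounds[OF assms(1) v] assms by (auto simp: digits_def)
    qed
    finally show "(\<Sum>i\<le>n. if edge_of n v = (i, j) then Poly_Mapping.lookup m v else 0)
        = (if j \<in> digits n v then Poly_Mapping.lookup m v else 0)" .
  qed
  finally show ?thesis .
qed

text \<open>The edges (n-1,n) and (1,n), contributed by y_1 and the inner y_l, cross nothing. The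
  edge (1,n-1), contributed by y_n, can only be crossed by an edge (j,n) with 1 < j < n-1, and y_n
  x_jn is a leading pair. All other crossings are leading pairs of x-variables.\<close>

lemma noncrossing_edge_mult:
  assumes n: "n \<ge> 5" and std: "\<not> divisible_by (lead_monomials n) m"
  shows "noncrossing n (edge_mult n m)"
  unfolding noncrossing_def
proof (intro conjI allI impI)
  show "i < j" "j \<le> n" if "edge_mult n m i j > 0" for i j
    using that n by (auto simp: edge_mult_eq split: if_splits)
  show "edge_mult n m i k = 0 \<or> edge_mult n m j l = 0" if "i < j" "j < k" "k < l" for i j k l
  proof (cases "1 \<le> i \<and> l \<le> n")
    case False
    then show ?thesis using n that by (auto simp: edge_mult_eq)
  next
    case True
    \<comment> \<open>From i < j < k < l <= n it follows that 1 < j < n-1 and k < n. Hence (j,l) is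
      none of the three edges shared with y-variables, and (i,k) can only be the shared edge
      (1,n-1).\<close>
    then have jl: "edge_mult n m j l = Poly_Mapping.lookup m (X j l)"
      using n that by (auto simp: edge_mult_eq)
    have ik: "edge_mult n m i k = Poly_Mapping.lookup m (X i k)
        + (if (i, k) = (1, n - 1) then Poly_Mapping.lookup m (Y n) else 0)"
      using True n that by (auto simp: edge_mult_eq)
    have "Poly_Mapping.lookup m (X i k) = 0 \<or> Poly_Mapping.lookup m (X j l) = 0"
      by (rule standard_lookup[OF std lead_pair.cross]) (use True that in auto)
    moreover have "Poly_Mapping.lookup m (Y n) = 0 \<or> Poly_Mapping.lookup m (X j l) = 0"
      if "(i, k) = (1, n - 1)"
    proof -
      have "l = n" using that True \<open>k < l\<close> by auto
      then show ?thesis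
        using that \<open>i < j\<close> \<open>j < k\<close> by (auto intro!: standard_lookup[OF std] lead_pair.yn_xin)
    qed
    ultimately show ?thesis using ik jl by auto
  qed
qed

text \<open>The values of y_1 and y_n are led by their summand at l = n-1, so both share the
  position 3n-1 = 2n+(n-1) with y_(n-1). All other inner y_l have a position to themselves.\<close>

lemma digit_count_y:
  assumes "n \<ge> 5"
  shows "2 \<le> l \<Longrightarrow> l \<le> n - 2 \<Longrightarrow> digit_count n m (2 * n + l) = Poly_Mapping.lookup m (Y l)"
    and "digit_count n m (3 * n - 1) = Poly_Mapping.lookup m (Y 1) + Poly_Mapping.lookup m (Y n)
      + Poly_Mapping.lookup m (Y (n - 1))"
proof -
  have x: "k \<notin> digits n v" if "v \<in> x_vars n" "k > 2 * n" for k v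
    using that by (cases v) (auto simp: digits_def S_vars_iff)
  have n2: "n \<ge> 2" using assms by simp
  have y: "k \<in> digits n (Y l) \<longleftrightarrow> k = (if l = 1 \<or> l = n then 3 * n - 1 else 2 * n + l)"
    if "k > 2 * n" "l \<le> n" for k l
    using that assms by (auto simp: digits_def)
  have eq: "digit_count n m k = (if k = 3 * n - 1 then Poly_Mapping.lookup m (Y 1) + Poly_Mapping.lookup m (Y n) else 0)
      + (if k - 2 * n \<in> {2..n-1} then Poly_Mapping.lookup m (Y (k - 2 * n)) else 0)" if k: "k > 2 * n" for k
  proof -
    let ?g = "\<lambda>v. if k \<in> digits n v then Poly_Mapping.lookup m v else 0"
    have "(\<Sum>v\<in>x_vars n. ?g v) = 0" using x k by simp
    moreover have "(\<Sum>l=2..n-1. ?g (Y l)) = (\<Sum>l=2..n-1. if l = k - 2 * n then Poly_Mapping.lookup m (Y (k - 2 * n)) else 0)"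
    proof (rule sum.cong[OF refl])
      fix l assume l: "l \<in> {2..n-1}"
      then have "k \<in> digits n (Y l) \<longleftrightarrow> l = k - 2 * n"
        using y[OF k, of l] k n2 by auto
      then show "?g (Y l) = (if l = k - 2 * n then Poly_Mapping.lookup m (Y (k - 2 * n)) else 0)" by auto
    qed
    moreover have "?g (Y 1) + ?g (Y n)
        = (if k = 3 * n - 1 then Poly_Mapping.lookup m (Y 1) + Poly_Mapping.lookup m (Y n) else 0)"
      using y[OF k, of 1] y[OF k, of n] n2 by auto
    ultimately show ?thesis
      unfolding digit_count_def sum_S_vars[OF n2] by simp
  qed
  show "digit_count n m (2 * n + l) = Poly_Mapping.lookup m (Y l)" if "2 \<le> l" "l \<le> n - 2"
    using that assms by (subst eq) auto
  show "digit_count n m (3 * n - 1) = Poly_Mapping.lookup m (Y 1) + Poly_Mapping.lookup m (Y n)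
      + Poly_Mapping.lookup m (Y (n - 1))"
  proof -
    have "3 * n - 1 - 2 * n = n - 1" "n - 1 \<in> {2..n-1}" "3 * n - 1 > 2 * n" using assms by auto
    then show ?thesis by (simp only: eq if_True refl)
  qed
qed

lemma standard_monomial_unique:
  assumes n: "n \<ge> 5"
    and m: "m \<in> monomials (S_vars n)" "m' \<in> monomials (S_vars n)"
    and std: "\<not> divisible_by (lead_monomials n) m" "\<not> divisible_by (lead_monomials n) m'"
    and eq: "\<And>k. k < 3 * n \<Longrightarrow> digit_count n m k = digit_count n m' k"
  shows "m = m'"
proof -
  have zero: "edge_mult n r i j = 0" if "\<not> (1 \<le> i \<and> i < j \<and> j \<le> n)" for r i j
    using that n by (auto simp: edge_mult_eq)
  have "edge_mult n m = edge_mult n m'"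
  proof (rule noncrossing_unique[OF noncrossing_edge_mult[OF n std(1)] noncrossing_edge_mult[OF n std(2)]])
    show "(\<Sum>j\<le>n. edge_mult n m i j) = (\<Sum>j\<le>n. edge_mult n m' i j)" for i
    proof (cases "1 \<le> i \<and> i \<le> n")
      case True
      then show ?thesis using n by (simp add: out_degree_edge_mult eq)
    qed (auto simp: zero)
    show "(\<Sum>i\<le>n. edge_mult n m i j) = (\<Sum>i\<le>n. edge_mult n m' i j)" for j
    proof (cases "1 \<le> j \<and> j \<le> n")
      case True
      then show ?thesis using n by (simp add: in_degree_edge_mult eq)
    qed (auto simp: zero)
  qed
  then have edge: "edge_mult n m i j = edge_mult n m' i j" for i j by simp
  let ?x = "\<lambda>r i j. Poly_Mapping.lookup r (X i j)" and ?y = "\<lambda>r l. Poly_Mapping.lookup r (Y l)"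
  have x: "?x m i j = ?x m' i j"
    if "1 \<le> i" "i < j" "j \<le> n" "(i, j) \<noteq> (n - 1, n)" "(i, j) \<noteq> (1, n - 1)" "(i, j) \<noteq> (1, n)" for i j
    using edge[of i j] that by (simp only: edge_mult_eq[OF n] if_False if_True simp_thms add_0_right)
  have ysplit: "(\<Sum>l=2..n-1. ?y r l) = (\<Sum>l=2..n-2. ?y r l) + ?y r (n - 1)" for r
  proof -
    have "{2..n-1} = insert (n - 1) {2..n-2}" using n by auto
    moreover have "n - 1 \<notin> {2..n-2}" using n by auto
    ultimately show ?thesis by (simp only: sum.insert finite_atLeastAtMost not_False_eq_True add.commute)
  qed
  have y: "?y m l = ?y m' l" if "2 \<le> l" "l \<le> n - 2" for l
    using eq[of "2 * n + l"] that n by (simp add: digit_count_y(1))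
  have w: "(\<Sum>l=2..n-2. ?y m l) = (\<Sum>l=2..n-2. ?y m' l)"
    by (rule sum.cong) (auto intro: y)
  have e1: "edge_mult n r (n - 1) n = ?x r (n - 1) n + ?y r 1"
    and e2: "edge_mult n r 1 (n - 1) = ?x r 1 (n - 1) + ?y r n"
    and e3: "edge_mult n r 1 n = ?x r 1 n + ((\<Sum>l=2..n-2. ?y r l) + ?y r (n - 1))" for r
  proof -
    have "1 \<le> n - 1" "n - 1 < n" "1 < n - 1" "1 < n" "n - 1 \<noteq> 1" "n - 1 \<noteq> n" "n \<noteq> n - 1" "1 \<noteq> n - 1" "n \<noteq> 1"
      using n by auto
    then show "edge_mult n r (n - 1) n = ?x r (n - 1) n + ?y r 1"
      and "edge_mult n r 1 (n - 1) = ?x r 1 (n - 1) + ?y r n"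
      and "edge_mult n r 1 n = ?x r 1 n + ((\<Sum>l=2..n-2. ?y r l) + ?y r (n - 1))"
      by (simp_all add: edge_mult_eq[OF n] ysplit del: One_nat_def)
  qed
  have eqs: "?x m (n - 1) n + ?y m 1 = ?x m' (n - 1) n + ?y m' 1"
    "?x m 1 (n - 1) + ?y m n = ?x m' 1 (n - 1) + ?y m' n"
    "?x m 1 n + ?y m (n - 1) = ?x m' 1 n + ?y m' (n - 1)"
    "?y m 1 + ?y m n + ?y m (n - 1) = ?y m' 1 + ?y m' n + ?y m' (n - 1)"
    using edge[of "n - 1" n] edge[of 1 "n - 1"] edge[of 1 n] w eq[of "3 * n - 1"] n
    unfolding e1 e2 e3 digit_count_y(2)[OF n] by auto
  have zeros: "?y r 1 = 0 \<or> ?x r 1 n = 0" "?y r 1 = 0 \<or> ?x r 1 (n - 1) = 0" "?y r n = 0 \<or> ?x r 1 n = 0"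
    if "\<not> divisible_by (lead_monomials n) r" for r
    using standard_lookup[OF that lead_pair.y1_x1n] standard_lookup[OF that lead_pair.y1_x1n']
      standard_lookup[OF that lead_pair.yn_xin, of 1] n by auto
  \<comment> \<open>Let y_1 and y_n grow by alpha and beta from \<open>m\<close> to
    \<open>m'\<close>. By \<open>eqs\<close>, x_1n grows by alpha + beta, and x_(n-1)n, x_1(n-1),
    y_(n-1) fall by alpha, beta, alpha + beta. If alpha + beta > 0, then \<open>m'\<close> contains
    x_1n, hence neither y_1 nor y_n, so alpha and beta are at most 0, a contradiction. If alpha = -
    beta > 0, then \<open>m'\<close> contains both y_1 and x_1(n-1). The opposite signs exchange
    \<open>m\<close> and \<open>m'\<close>.\<close>
  have special: "?x m (n - 1) n = ?x m' (n - 1) n" "?x m 1 (n - 1) = ?x m' 1 (n - 1)" "?x m 1 n = ?x m' 1 n"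
    "?y m 1 = ?y m' 1" "?y m n = ?y m' n" "?y m (n - 1) = ?y m' (n - 1)"
    using eqs zeros[OF std(1)] zeros[OF std(2)] by linarith+
  show ?thesis
  proof (rule poly_mapping_eqI)
    fix v
    show "Poly_Mapping.lookup m v = Poly_Mapping.lookup m' v"
    proof (cases "v \<in> S_vars n")
      case False
      then show ?thesis using m by (metis in_keys_iff mem_Collect_eq monomials_def subsetD)
    next
      case True
      show ?thesis
      proof (cases v)
        case (X i j)
        then show ?thesis using True x[of i j] special by (auto simp: S_vars_iff)
      next
        case (Y l)
        then consider "l = 1" | "l = n" | "l = n - 1" | "2 \<le> l" "l \<le> n - 2"
          using True by (auto simp: S_vars_iff) linarith
        then show ?thesis using Y special y by cases auto
      qed
    qed
  qed
qed

lemma J_ideal_standard_eq_0: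
  fixes q :: "(var, 'k::idom) mpoly"
  assumes n: "n \<ge> 5" and q: "q \<in> J_ideal n"
    and std: "\<forall>m\<in>Poly_Mapping.keys q. \<not> divisible_by (lead_monomials n) m"
  shows "q = 0"
proof -
  note keys = ideal_poly_ring_keys[OF ideal_J_ideal q]
  \<comment> \<open>Every digit count of a monomial is at most its total degree, so with this base
    no carrying occurs in any monomial of \<open>q\<close>.\<close>
  define N where "N = 2 + (\<Sum>m\<in>Poly_Mapping.keys q. deg_in (S_vars n) m)"
  have N: "N \<ge> 2" by (simp add: N_def)
  have bound: "digit_count n m k < N" if "m \<in> Poly_Mapping.keys q" for m k
  proof -
    have "digit_count n m k \<le> deg_in (S_vars n) m"
      unfolding digit_count_def deg_in_def by (rule sum_mono) auto
    also have "\<dots> \<le> (\<Sum>m\<in>Poly_Mapping.keys q. deg_in (S_vars n) m)"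
      by (rule member_le_sum) (use that in auto)
    finally show ?thesis by (simp add: N_def)
  qed
  show ?thesis
  proof (rule mpoly_eval_eq_0_imp)
    show "mpoly_eval (generic_point n N) q = 0"
      unfolding generic_point_def using n q by (intro mpoly_eval_J_ideal) auto
    show "monom_eval (generic_point n N :: var \<Rightarrow> 'k poly) m \<noteq> 0" if "m \<in> Poly_Mapping.keys q" for m
      using that keys by (intro monom_eval_neq_0 generic_point_neq_0[OF n N]) (auto simp: monomials_def)
    show "inj_on (\<lambda>m. degree (monom_eval (generic_point n N :: var \<Rightarrow> 'k poly) m)) (Poly_Mapping.keys q)"
    proof (rule inj_onI)
      fix m m'
      assume mm: "m \<in> Poly_Mapping.keys q" "m' \<in> Poly_Mapping.keys q"
        and "degree (monom_eval (generic_point n N :: var \<Rightarrow> 'k poly) m)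
          = degree (monom_eval (generic_point n N :: var \<Rightarrow> 'k poly) m')"
      then have "(\<Sum>k<3 * n. digit_count n m k * N ^ k) = (\<Sum>k<3 * n. digit_count n m' k * N ^ k)"
        using degree_monom_eval_generic_point[OF n N, where 'k = 'k, of m]
          degree_monom_eval_generic_point[OF n N, where 'k = 'k, of m']
          subsetD[OF keys mm(1)] subsetD[OF keys mm(2)] by simp
      from digit_expansion_unique[OF bound[OF mm(1)] bound[OF mm(2)] this]
      have "digit_count n m k = digit_count n m' k" if "k < 3 * n" for k
        using that .
      then show "m = m'"
        using mm keys std by (intro standard_monomial_unique[OF n]) auto
    qed
  qed
qed

section \<open>The term order\<close>

lemma deg_in_add [simp]: "deg_in A (a + b) = deg_in A a + deg_in A b"
  by (simp add: deg_in_def lookup_add sum.distrib)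

lemma deg_in_zero [simp]: "deg_in A 0 = 0"
  by (simp add: deg_in_def)

lemma lookup_x_part: "Poly_Mapping.lookup (x_part n m) v = (if v \<in> x_vars n then Poly_Mapping.lookup m v else 0)"
  by (simp add: x_part_def lookup_sum lookup_single when_def)

lemma x_part_add: "x_part n (a + b) = x_part n a + x_part n b"
  by (rule poly_mapping_eqI) (simp add: lookup_x_part lookup_add)

lemma x_part_in_monomials [simp]: "x_part n m \<in> monomials (x_vars n)"
  by (auto simp: monomials_def in_keys_iff lookup_x_part split: if_splits)

lemma x_part_eq: "m \<in> monomials (x_vars n) \<Longrightarrow> x_part n m = m"
  by (rule poly_mapping_eqI) (auto simp: lookup_x_part monomials_def in_keys_iff)

lemma lexord_map_add:
  fixes f g h :: "'a \<Rightarrow> nat"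
  shows "(map f L, map g L) \<in> lexord less_than
    \<Longrightarrow> (map (\<lambda>x. f x + h x) L, map (\<lambda>x. g x + h x) L) \<in> lexord less_than"
  by (induction L) auto

lemma monomial_eq_by_parts:
  assumes "n \<ge> 1" "a \<in> monomials (S_vars n)" "b \<in> monomials (S_vars n)"
    and "y_exponents n a = y_exponents n b" "x_part n a = x_part n b"
  shows "a = b"
proof (rule poly_mapping_eqI)
  fix v
  show "Poly_Mapping.lookup a v = Poly_Mapping.lookup b v"
  proof (cases "v \<in> S_vars n")
    case False
    then show ?thesis using assms(2,3) by (metis in_keys_iff mem_Collect_eq monomials_def subsetD)
  next
    case True
    show ?thesis
    proof (cases v)
      case (X i j)
      then have "v \<in> x_vars n" using True by (simp add: S_vars_iff)
      then show ?thesis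
        using arg_cong[OF assms(5), of "\<lambda>m. Poly_Mapping.lookup m v"] by (simp add: lookup_x_part)
    next
      case (Y l)
      then have "l = n \<or> l \<in> {1..<n}" using True by (auto simp: S_vars_iff)
      then show ?thesis using assms(4) Y by (auto simp: y_exponents_def)
    qed
  qed
qed

text \<open>Every criterion compares additive data, so it is compatible with multiplication and
  passes ties on. The reversed comparisons in (ii) and (iii) do not endanger 1 being the least
  monomial, since the total degree is compared before them.\<close>

lemma monomial_order_term_less:
  assumes n: "n \<ge> 1" and circ: "monomial_order (x_vars n) circ"
  shows "monomial_order (S_vars n) (term_less n circ)"
  unfolding monomial_order_def
proof (intro conjI ballI impI)
  note circ_irrefl = monomial_order_irrefl[OF circ]
  note circ_trans = monomial_order_trans[OF circ]
  have lex_irrefl: "(xs, xs) \<notin> lexord less_than" for xs :: "nat list"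
    by (rule lexord_irreflexive) auto
  have lex_trans: "(xs, zs) \<in> lexord less_than"
    if "(xs, ys) \<in> lexord less_than" "(ys, zs) \<in> lexord less_than" for xs ys zs :: "nat list"
    using lexord_trans[OF that] by simp
  fix a assume a: "a \<in> monomials (S_vars n)"
  show "\<not> term_less n circ a a"
    using lex_irrefl circ_irrefl by (auto simp: term_less_def Let_def)
  show "term_less n circ 0 a" if a0: "a \<noteq> 0"
  proof -
    obtain v where v: "Poly_Mapping.lookup a v \<noteq> 0" using a0 by (metis lookup_zero poly_mapping_eqI)
    then have "v \<in> S_vars n" using a by (auto simp: monomials_def in_keys_iff)
    then have "deg_in (S_vars n) a > 0"
      using v by (auto simp: deg_in_def intro: ccontr)
    then show ?thesis by (simp add: term_less_def)
  qed
  fix b assume b: "b \<in> monomials (S_vars n)"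
  show "term_less n circ a b \<or> term_less n circ b a" if "a \<noteq> b"
  proof -
    have "(y_exponents n a, y_exponents n b) \<in> lexord less_than \<or> y_exponents n a = y_exponents n b
        \<or> (y_exponents n b, y_exponents n a) \<in> lexord less_than"
      by (rule lexord_linear) auto
    moreover have "circ (x_part n a) (x_part n b) \<or> circ (x_part n b) (x_part n a)"
      if "y_exponents n a = y_exponents n b"
      using monomial_eq_by_parts[OF n a b that] \<open>a \<noteq> b\<close>
      by (intro monomial_order_total[OF circ]) auto
    \<comment> \<open>These rules peel off one numerical criterion each, in either direction, and
      leave totality of the criteria below it.\<close>
    moreover have less: "(x < y \<or> x = y \<and> P) \<or> y < x \<or> y = x \<and> Q"
      and greater: "(x > y \<or> x = y \<and> P) \<or> y > x \<or> y = x \<and> Q"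
      if "P \<or> Q" for x y :: nat and P Q
      using that by auto
    ultimately show ?thesis
      unfolding term_less_def Let_def by (intro less greater) blast
  qed
  fix c assume c: "c \<in> monomials (S_vars n)"
  show "term_less n circ a c" if "term_less n circ a b" "term_less n circ b c"
    using that lex_trans circ_trans[of "x_part n a" "x_part n b" "x_part n c"]
    unfolding term_less_def Let_def by (elim disjE conjE) auto
  show "term_less n circ (a + c) (b + c)" if "term_less n circ a b"
  proof -
    have lex: "(y_exponents n (a + c), y_exponents n (b + c)) \<in> lexord less_than"
      if "(y_exponents n a, y_exponents n b) \<in> lexord less_than"
      using lexord_map_add[OF that[unfolded y_exponents_def]] by (simp add: y_exponents_def lookup_add)
    have "y_exponents n (a + c) = y_exponents n (b + c)" if "y_exponents n a = y_exponents n b"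
      using that by (simp add: y_exponents_def lookup_add)
    moreover have "circ (x_part n (a + c)) (x_part n (b + c))" if "circ (x_part n a) (x_part n b)"
      using monomial_order_add[OF circ that] by (simp add: x_part_add)
    ultimately show ?thesis
      using that lex unfolding term_less_def Let_def
      by (simp only: deg_in_add lookup_add add_less_cancel_right add_right_cancel) blast
  qed
qed

lemma finite_bounded_degree:
  assumes "finite V"
  shows "finite {m \<in> monomials V. deg_in V m \<le> D}"
proof (rule finite_imageD)
  show "inj_on Poly_Mapping.lookup {m \<in> monomials V. deg_in V m \<le> D}"
    by (rule inj_onI, rule poly_mapping_eqI) simp
  have "Poly_Mapping.lookup m v \<le> D" if "v \<in> V" "deg_in V m \<le> D" for m v
    using member_le_sum[of v V "Poly_Mapping.lookup m"] that assms by (auto simp: deg_in_def)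
  then have "Poly_Mapping.lookup ` {m \<in> monomials V. deg_in V m \<le> D}
      \<subseteq> {f. \<forall>v. (v \<in> V \<longrightarrow> f v \<in> {..D}) \<and> (v \<notin> V \<longrightarrow> f v = 0)}"
    by (auto simp: monomials_def in_keys_iff subset_iff)
  then show "finite (Poly_Mapping.lookup ` {m \<in> monomials V. deg_in V m \<le> D})"
    by (rule finite_subset) (rule finite_set_of_finite_funs[OF assms finite_atMost])
qed

text \<open>Since the total degree is compared before anything else, only finitely many monomials
  lie below a given one; this makes the reduction terminate.\<close>

lemma finite_term_less_below: "finite {b \<in> monomials (S_vars n). term_less n circ b a}"
  by (rule finite_subset[OF _ finite_bounded_degree[OF finite_S_vars, of n "deg_in (S_vars n) a"]])
     (auto simp: term_less_def Let_def)

section \<open>Leading monomials of the generators\<close>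

lemma pair_monomial_commute: "pair_monomial u v = pair_monomial v u"
  by (simp add: pair_monomial_def add.commute)

lemma pvar_mult: "pvar u * pvar v = Poly_Mapping.single (pair_monomial u v) 1"
  by (simp add: pvar_def pair_monomial_def mult_single)

lemma lookup_pair_monomial:
  "Poly_Mapping.lookup (pair_monomial u v) w = (if w = u then 1 else 0) + (if w = v then 1 else 0)"
  by (simp add: pair_monomial_def lookup_add lookup_single when_def)

lemma pair_monomial_neq:
  assumes "u \<noteq> u'" "u \<noteq> v'"
  shows "pair_monomial u v \<noteq> pair_monomial u' v'"
proof
  assume "pair_monomial u v = pair_monomial u' v'"
  from arg_cong[OF this, of "\<lambda>m. Poly_Mapping.lookup m u"] assms show False
    by (simp add: lookup_pair_monomial)
qed

lemma pair_monomial_in_monomials [simp]: "pair_monomial u v \<in> monomials V \<longleftrightarrow> u \<in> V \<and> v \<in> V"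
  by (simp add: pair_monomial_def)

lemma deg_in_pair_monomial:
  "finite A \<Longrightarrow> deg_in A (pair_monomial u v) = (if u \<in> A then 1 else 0) + (if v \<in> A then 1 else 0)"
  by (simp add: deg_in_def lookup_pair_monomial sum.distrib)

lemma finite_inner_y: "finite {Y i |i. 2 \<le> i \<and> i \<le> (n::nat)}"
proof -
  have "{Y i |i. 2 \<le> i \<and> i \<le> n} = Y ` {2..n}" by auto
  then show ?thesis by simp
qed

text \<open>All three terms have degree 2 and contain no y. The middle one is free of x_(n-1)n, so
  criterion (iii) either already favours it, namely when (k,l) = (n-1,n), or ties. In the latter
  case circularity decides.\<close>

lemma lead_monomial_Phi:
  fixes circ
  assumes circ: "circular TYPE('k::comm_ring_1) n circ"
    and ijkl: "1 \<le> i" "i < j" "j < k" "k < l" "l \<le> n"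
  shows "(Phi i j k l :: (var, 'k) mpoly) \<noteq> 0"
    and "lead_monomial (term_less n circ) (Phi i j k l :: (var, 'k) mpoly) = pair_monomial (X i k) (X j l)"
proof -
  let ?P = "Phi i j k l :: (var, 'k) mpoly"
  let ?a = "pair_monomial (X i j) (X k l)" and ?b = "pair_monomial (X i k) (X j l)"
    and ?c = "pair_monomial (X i l) (X j k)"
  have ord: "monomial_order (x_vars n) circ" using circ by (simp add: circular_def)
  have P: "?P = Poly_Mapping.single ?a 1 - Poly_Mapping.single ?b 1 + Poly_Mapping.single ?c 1"
    using ijkl by (simp add: Phi_def xv_def pvar_mult)
  have ne: "?a \<noteq> ?b" "?a \<noteq> ?c" "?b \<noteq> ?c"
    using ijkl by - (rule pair_monomial_neq; simp)+
  have "Poly_Mapping.lookup ?P m = (if m = ?a then 1 else if m = ?b then - 1 else if m = ?c then 1 else 0)" for m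
    using ne by (auto simp: P lookup_add lookup_minus lookup_single when_def)
  then have keys: "Poly_Mapping.keys ?P = {?a, ?b, ?c}"
    by (auto simp: in_keys_iff split: if_splits)
  show P0: "?P \<noteq> 0" using keys by auto
  have x: "{?a, ?b, ?c} \<subseteq> monomials (x_vars n)" and S: "{?a, ?b, ?c} \<subseteq> monomials (S_vars n)"
    using ijkl by (auto simp: S_vars_iff)
  have lead: "lead_monomial circ ?P = ?b"
    using circ ijkl unfolding circular_def pair_monomial_def by blast
  have lt: "circ ?a ?b" "circ ?c ?b"
    using lead_monomial_greatest[OF ord _ P0, of ?a] lead_monomial_greatest[OF ord _ P0, of ?c] keys lead x ne
    by auto
  have less: "term_less n circ m ?b" if m: "m \<in> {?a, ?c}" for m
  proof -
    have "deg_in (S_vars n) m = deg_in (S_vars n) ?b"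
      "deg_in {Y i |i. 2 \<le> i \<and> i \<le> n - 1} m = deg_in {Y i |i. 2 \<le> i \<and> i \<le> n - 1} ?b"
      using m ijkl by (auto simp: deg_in_pair_monomial finite_inner_y S_vars_iff)
    moreover have "Poly_Mapping.lookup ?b (X (n - 1) n) = 0"
      using ijkl by (auto simp: lookup_pair_monomial)
    moreover have "y_exponents n m = y_exponents n ?b"
      using m by (auto simp: y_exponents_def lookup_pair_monomial)
    moreover have "circ (x_part n m) (x_part n ?b)"
      using m lt x by (auto simp: x_part_eq)
    ultimately show ?thesis unfolding term_less_def Let_def by auto
  qed
  show "lead_monomial (term_less n circ) ?P = ?b"
    by (rule lead_monomial_eqI[OF monomial_order_term_less[OF _ ord]])
       (use keys S less ijkl in auto)
qed

definition edge_var :: "nat \<Rightarrow> nat \<Rightarrow> var" where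
  "edge_var i j = X (min i j) (max i j)"

text \<open>The terms of f_i have different y-factors, so nothing cancels and the coefficients are 1
  or -1; only the comparison of the terms matters.\<close>

lemma lead_monomial_f_poly:
  assumes ord: "monomial_order (S_vars n) lt"
    and i: "1 \<le> i" "i \<le> n" and j0: "1 \<le> j0" "j0 \<le> n" "j0 \<noteq> i"
    and less: "\<And>j. 1 \<le> j \<Longrightarrow> j \<le> n \<Longrightarrow> j \<noteq> i \<Longrightarrow> j \<noteq> j0
      \<Longrightarrow> lt (pair_monomial (edge_var i j) (Y j)) (pair_monomial (edge_var i j0) (Y j0))"
  shows "(f_poly n i :: (var, 'k::comm_ring_1) mpoly) \<noteq> 0"
    and "lead_monomial lt (f_poly n i :: (var, 'k) mpoly) = pair_monomial (edge_var i j0) (Y j0)"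
proof -
  let ?f = "f_poly n i :: (var, 'k) mpoly"
  let ?t = "\<lambda>j. pair_monomial (edge_var i j) (Y j)"
  define s :: "nat \<Rightarrow> 'k" where "s j = (if i < j then 1 else if j < i then - 1 else 0)" for j
  have "xv i j * yv j = Poly_Mapping.single (?t j) (s j)" for j
    by (auto simp: xv_def yv_def s_def pvar_mult edge_var_def single_uminus)
  then have f: "?f = (\<Sum>j=1..n. Poly_Mapping.single (?t j) (s j))"
    by (simp add: f_poly_def)
  have keys: "Poly_Mapping.keys ?f \<subseteq> {?t j |j. 1 \<le> j \<and> j \<le> n \<and> j \<noteq> i}"
  proof
    fix m assume "m \<in> Poly_Mapping.keys ?f"
    then obtain j where "j \<in> {1..n}" "m \<in> Poly_Mapping.keys (Poly_Mapping.single (?t j) (s j))"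
      using keys_sum_subset unfolding f by fast
    then show "m \<in> {?t j |j. 1 \<le> j \<and> j \<le> n \<and> j \<noteq> i}"
      by (auto simp: s_def split: if_splits)
  qed
  have t: "?t j = ?t j' \<longleftrightarrow> j = j'" for j j'
  proof
    assume "?t j = ?t j'"
    from arg_cong[OF this, of "\<lambda>m. Poly_Mapping.lookup m (Y j)"] show "j = j'"
      by (auto simp: lookup_pair_monomial edge_var_def split: if_splits)
  qed simp
  have "Poly_Mapping.lookup ?f (?t j0) = (\<Sum>j=1..n. if j = j0 then s j0 else 0)"
    unfolding f lookup_sum by (rule sum.cong) (auto simp: lookup_single when_def t)
  then have "Poly_Mapping.lookup ?f (?t j0) = s j0" using j0 by simp
  then have in_keys: "?t j0 \<in> Poly_Mapping.keys ?f"
    using j0(3) by (auto simp: in_keys_iff s_def)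
  then show "?f \<noteq> 0" by auto
  show "lead_monomial lt ?f = ?t j0"
  proof (rule lead_monomial_eqI[OF ord keys_f_poly[OF i] in_keys])
    fix m assume "m \<in> Poly_Mapping.keys ?f" "m \<noteq> ?t j0"
    then show "lt m (?t j0)" using keys less by blast
  qed
qed

text \<open>Terms with an inner y lose by (ii), which leaves y_1 and y_n. For i = n only y_1
  remains, as x_nn = 0. For i = n-1 the term with y_n contains x_(n-1)n and loses by (iii). For i <=
  n-2 the two are compared by (iv), and y_n wins.\<close>

lemma term_less_f_poly_terms:
  assumes n: "n \<ge> 5" and i: "1 \<le> i" "i \<le> n" and j: "1 \<le> j" "j \<le> n" "j \<noteq> i" "j \<noteq> j0"
    and j0: "j0 = 1 \<and> (i = n \<or> i = n - 1) \<or> j0 = n \<and> i \<le> n - 2"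
  shows "term_less n circ (pair_monomial (edge_var i j) (Y j)) (pair_monomial (edge_var i j0) (Y j0))"
proof -
  let ?a = "pair_monomial (edge_var i j) (Y j)" and ?b = "pair_monomial (edge_var i j0) (Y j0)"
  let ?e = "deg_in {Y i |i. 2 \<le> i \<and> i \<le> n - 1}"
  have d: "deg_in (S_vars n) ?a = deg_in (S_vars n) ?b"
    using assms by (auto simp: deg_in_pair_monomial edge_var_def S_vars_iff min_def max_def)
  have eb: "?e ?b = 0" and ea: "?e ?a = (if j = 1 \<or> j = n then 0 else 1)"
    using assms by (auto simp: deg_in_pair_monomial finite_inner_y edge_var_def)
  have ub: "Poly_Mapping.lookup ?b (X (n - 1) n) = 0"
    using assms by (auto simp: lookup_pair_monomial edge_var_def min_def max_def)
  show ?thesis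
  proof (cases "j = 1 \<or> j = n")
    case False
    then show ?thesis using d ea eb by (simp add: term_less_def)
  next
    case True
    show ?thesis
    proof (cases "i = n - 1")
      case True
      then have "j = n" using \<open>j = 1 \<or> j = n\<close> j j0 n by auto
      then have "Poly_Mapping.lookup ?a (X (n - 1) n) = 1"
        using True n by (auto simp: lookup_pair_monomial edge_var_def)
      then show ?thesis using d ea eb ub \<open>j = n\<close> by (simp add: term_less_def)
    next
      case False
      then have "i \<le> n - 2" "j = 1" "j0 = n" using True j j0 n by auto
      then have "Poly_Mapping.lookup ?a (X (n - 1) n) = 0"
        using n by (auto simp: lookup_pair_monomial edge_var_def min_def max_def)
      moreover have "(y_exponents n ?a, y_exponents n ?b) \<in> lexord less_than"
        using \<open>j = 1\<close> \<open>j0 = n\<close> n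
        by (simp add: y_exponents_def lookup_pair_monomial edge_var_def)
      ultimately show ?thesis using d ea eb ub \<open>j = 1\<close> by (simp add: term_less_def)
    qed
  qed
qed

lemma lead_monomial_attained:
  fixes circ
  assumes n: "n \<ge> 5" and circ: "circular TYPE('k::comm_ring_1) n circ" and a: "a \<in> lead_monomials n"
  shows "\<exists>g\<in>(J_ideal n :: (var, 'k) mpoly set). g \<noteq> 0 \<and> lead_monomial (term_less n circ) g = a"
proof -
  have ord: "monomial_order (S_vars n) (term_less n circ)"
    using circ n by (intro monomial_order_term_less) (auto simp: circular_def)
  have f: "\<exists>g\<in>(J_ideal n :: (var, 'k) mpoly set). g \<noteq> 0 \<and>
      lead_monomial (term_less n circ) g = pair_monomial (Y j0) (edge_var i j0)"
    if "1 \<le> i" "i \<le> n" "j0 = 1 \<and> (i = n \<or> i = n - 1) \<or> j0 = n \<and> i \<le> n - 2" for i j0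
  proof (rule bexI[OF _ f_poly_in_J_ideal[OF that(1,2)]])
    have j0: "1 \<le> j0" "j0 \<le> n" "j0 \<noteq> i" using that n by auto
    note lead = lead_monomial_f_poly[OF ord that(1,2) j0 term_less_f_poly_terms[OF n that(1,2) _ _ _ _ that(3)],
        where 'k = 'k]
    show "(f_poly n i :: (var, 'k) mpoly) \<noteq> 0 \<and>
      lead_monomial (term_less n circ) (f_poly n i :: (var, 'k) mpoly) = pair_monomial (Y j0) (edge_var i j0)"
      using lead by (simp add: pair_monomial_commute[of "Y j0"])
  qed
  obtain u v where uv: "lead_pair n u v" "a = pair_monomial u v"
    using a by (auto simp: lead_monomials_def)
  from uv(1) show ?thesis
  proof cases
    case (cross i j k l)
    then show ?thesis using lead_monomial_Phi[OF circ, of i j k l] Phi_in_J_ideal[of i j k l n, where 'k = 'k] uv(2)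
      by blast
  next
    case y1_x1n
    then show ?thesis using f[of n 1] uv(2) n by (simp add: edge_var_def)
  next
    case y1_x1n'
    then show ?thesis using f[of "n - 1" 1] uv(2) n by (simp add: edge_var_def)
  next
    case (yn_xin i)
    then show ?thesis using f[of i n] uv(2) n by (simp add: edge_var_def)
  qed
qed


section \<open>Non-faces\<close>

text \<open>The face condition of the subdivision in pairwise form. The new vertex can be added to
  \<open>g\<close> only if \<open>g\<close> together with \<open>Diag 1 (n - 1)\<close> and
  \<open>W1\<close> is a face before subdividing, that is, if \<open>W2\<close> is absent and
  nothing crosses this diagonal. So the complex is flag: its non-faces are detected by pairs, as are
  the multiples of the leading monomials.\<close>

definition good_face :: "nat \<Rightarrow> vertex set \<Rightarrow> bool" where
  "good_face n q \<longleftrightarrow> (\<forall>d\<in>q. \<forall>d'\<in>q. \<not> crosses d d') \<and> \<not> (W1 \<in> q \<and> W2 \<in> q)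
    \<and> \<not> (Diag 1 (n - 1) \<in> q \<and> W1 \<in> q)
    \<and> (NewV \<in> q \<longrightarrow> W2 \<notin> q \<and> (\<forall>d\<in>q. \<not> crosses d (Diag 1 (n - 1)) \<and> \<not> crosses (Diag 1 (n - 1)) d))"

lemma sc_join_A_S0_iff:
  "g \<in> sc_join (A_complex n) S0_complex \<longleftrightarrow>
    g \<subseteq> diagonals n \<union> {W1, W2} \<and> (\<forall>d\<in>g. \<forall>d'\<in>g. \<not> crosses d d') \<and> \<not> (W1 \<in> g \<and> W2 \<in> g)"
  (is "_ \<longleftrightarrow> ?R")
proof
  have W: "W1 \<notin> diagonals n" "W2 \<notin> diagonals n" by (auto simp: diagonals_def)
  assume "g \<in> sc_join (A_complex n) S0_complex"
  then obtain a h where "a \<in> A_complex n" "h \<in> S0_complex" "g = a \<union> h" by (auto simp: sc_join_def)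
  then show ?R using W by (auto simp: A_complex_def S0_complex_def)
next
  assume g: ?R
  then have "g \<inter> diagonals n \<in> A_complex n" by (auto simp: A_complex_def)
  moreover have "g \<inter> {W1, W2} \<in> S0_complex" using g by (auto simp: S0_complex_def)
  moreover have "g = (g \<inter> diagonals n) \<union> (g \<inter> {W1, W2})" using g by auto
  ultimately show "g \<in> sc_join (A_complex n) S0_complex" unfolding sc_join_def by blast
qed

lemma K_complex_iff:
  assumes "n \<ge> 5"
  shows "q \<in> K_complex n \<longleftrightarrow> q \<subseteq> diagonals n \<union> {W1, W2, NewV} \<and> good_face n q"
proof -
  let ?AS = "sc_join (A_complex n) S0_complex" and ?D = "Diag 1 (n - 1)"
  have D: "?D \<in> diagonals n" and V: "NewV \<notin> diagonals n"
    using assms by (auto simp: diagonals_def)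
  have cr: "\<not> crosses NewV d" "\<not> crosses d NewV" "\<not> crosses W1 d" "\<not> crosses d W1" "\<not> crosses ?D ?D" for d
    by (cases d; simp)+
  show ?thesis
  proof (cases "NewV \<in> q")
    case False
    then have "q \<in> K_complex n \<longleftrightarrow> q \<in> ?AS \<and> \<not> {?D, W1} \<subseteq> q"
      unfolding K_complex_def stellar_def by auto
    then show ?thesis
      unfolding sc_join_A_S0_iff good_face_def using False by auto
  next
    case True
    have "q \<in> K_complex n \<longleftrightarrow> (\<exists>g. q = insert NewV g \<and> g \<in> ?AS \<and> \<not> {?D, W1} \<subseteq> g \<and> {?D, W1} \<union> g \<in> ?AS)"
      using True V unfolding K_complex_def stellar_def sc_join_A_S0_iff by auto
    \<comment> \<open>Faces of the unsubdivided complex avoid \<open>NewV\<close>, so the witness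
      \<open>g\<close> can only be \<open>q - {NewV}\<close>.\<close>
    also have "\<dots> \<longleftrightarrow> q - {NewV} \<in> ?AS \<and> \<not> {?D, W1} \<subseteq> q - {NewV} \<and> {?D, W1} \<union> (q - {NewV}) \<in> ?AS"
    proof
      assume "\<exists>g. q = insert NewV g \<and> g \<in> ?AS \<and> \<not> {?D, W1} \<subseteq> g \<and> {?D, W1} \<union> g \<in> ?AS"
      then obtain g where g: "q = insert NewV g" "g \<in> ?AS" "\<not> {?D, W1} \<subseteq> g" "{?D, W1} \<union> g \<in> ?AS" by blast
      then have "q - {NewV} = g" using V by (auto simp: sc_join_A_S0_iff)
      with g show "q - {NewV} \<in> ?AS \<and> \<not> {?D, W1} \<subseteq> q - {NewV} \<and> {?D, W1} \<union> (q - {NewV}) \<in> ?AS" by simp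
    next
      assume "q - {NewV} \<in> ?AS \<and> \<not> {?D, W1} \<subseteq> q - {NewV} \<and> {?D, W1} \<union> (q - {NewV}) \<in> ?AS"
      moreover have "q = insert NewV (q - {NewV})" using True by auto
      ultimately show "\<exists>g. q = insert NewV g \<and> g \<in> ?AS \<and> \<not> {?D, W1} \<subseteq> g \<and> {?D, W1} \<union> g \<in> ?AS"
        by (intro exI conjI) (assumption | elim conjE)+
    qed
    also have "\<dots> \<longleftrightarrow> q \<subseteq> diagonals n \<union> {W1, W2, NewV} \<and> good_face n q"
    proof -
      define g where "g = q - {NewV}"
      have q: "q = insert NewV g" and g: "NewV \<notin> g" using True by (auto simp: g_def)
      have c1: "(\<forall>d\<in>q. \<forall>d'\<in>q. \<not> crosses d d') \<longleftrightarrow> (\<forall>d\<in>g. \<forall>d'\<in>g. \<not> crosses d d')"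
        using cr unfolding q by blast
      have c2: "(\<forall>d\<in>q. \<not> crosses d ?D \<and> \<not> crosses ?D d) \<longleftrightarrow> (\<forall>d\<in>g. \<not> crosses d ?D \<and> \<not> crosses ?D d)"
        using cr unfolding q by blast
      have c3: "(\<forall>d\<in>{?D, W1} \<union> g. \<forall>d'\<in>{?D, W1} \<union> g. \<not> crosses d d') \<longleftrightarrow>
          (\<forall>d\<in>g. \<forall>d'\<in>g. \<not> crosses d d') \<and> (\<forall>d\<in>g. \<not> crosses d ?D \<and> \<not> crosses ?D d)"
        using cr by blast
      have s1: "{?D, W1} \<union> g \<subseteq> diagonals n \<union> {W1, W2} \<longleftrightarrow> g \<subseteq> diagonals n \<union> {W1, W2}"
        using D by blast
      have s2: "q \<subseteq> diagonals n \<union> {W1, W2, NewV} \<longleftrightarrow> g \<subseteq> diagonals n \<union> {W1, W2}"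
        using g unfolding q by blast
      have w: "W1 \<in> q \<longleftrightarrow> W1 \<in> g" "W2 \<in> q \<longleftrightarrow> W2 \<in> g" "?D \<in> q \<longleftrightarrow> ?D \<in> g"
          "W1 \<in> {?D, W1} \<union> g" "W2 \<in> {?D, W1} \<union> g \<longleftrightarrow> W2 \<in> g"
          "{?D, W1} \<subseteq> g \<longleftrightarrow> ?D \<in> g \<and> W1 \<in> g"
        unfolding q by auto
      show ?thesis
        unfolding sc_join_A_S0_iff good_face_def g_def[symmetric] c1 c2 c3 s1 s2 w
        using True by blast
    qed
    finally show ?thesis .
  qed
qed

text \<open>Vertices of the simplex occur in none of the conditions of \<open>good_face\<close>, so
  they can be added or removed freely.\<close>

lemma KD_complex_iff:
  assumes n: "n \<ge> 5" and q: "q \<subseteq> KD_vertices n"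
  shows "q \<in> KD_complex n \<longleftrightarrow> good_face n q"
proof -
  let ?S = "Simp ` {0..2 * n - 4}" and ?K = "diagonals n \<union> {W1, W2, NewV}"
  have faces: "(`) Simp ` simplex (2 * n - 4) = Pow ?S"
    unfolding simplex_def by (rule image_Pow_surj) simp
  have cr: "\<not> crosses (Simp k) d" "\<not> crosses d (Simp k)" for k d by (cases d; simp)+
  have good: "good_face n (g \<union> h) \<longleftrightarrow> good_face n g" if "h \<subseteq> ?S" for g h
    using that cr unfolding good_face_def by blast
  show ?thesis
  proof
    assume "q \<in> KD_complex n"
    then obtain g h where "g \<in> K_complex n" "h \<subseteq> ?S" "q = g \<union> h"
      unfolding KD_complex_def sc_join_def faces by blast
    then show "good_face n q" using good K_complex_iff[OF n] by simp
  next
    assume "good_face n q"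
    moreover have "q = (q \<inter> ?K) \<union> (q \<inter> ?S)" using q by (auto simp: KD_vertices_def)
    ultimately have "q \<inter> ?K \<in> K_complex n"
      using good[of "q \<inter> ?S" "q \<inter> ?K"] K_complex_iff[OF n] by auto
    moreover have "q \<inter> ?S \<in> (`) Simp ` simplex (2 * n - 4)"
      unfolding faces by blast
    ultimately show "q \<in> KD_complex n"
      unfolding KD_complex_def sc_join_def using \<open>q = (q \<inter> ?K) \<union> (q \<inter> ?S)\<close> by blast
  qed
qed

text \<open>Crossing diagonals match the Phi_ijkl, the pair \<open>W1\<close>, \<open>W2\<close>
  matches y_1 x_1n, and the subdivided edge matches y_1 x_1(n-1). The diagonals crossing
  \<open>Diag 1 (n - 1)\<close> are those from n to some i with 1 < i < n-1. Together with
  \<open>W2\<close>, which stands for x_1n, they are the vertices excluded by \<open>NewV\<close>,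
  matching the y_n x_in with i <= n-2.\<close>

lemma good_face_iff:
  assumes n: "n \<ge> 5" and q: "q \<subseteq> KD_vertices n"
  shows "good_face n q \<longleftrightarrow> \<not> (\<exists>u v. lead_pair n u v \<and> u \<in> vertex_var n ` q \<and> v \<in> vertex_var n ` q)"
proof -
  have inj: "inj_on (vertex_var n) (KD_vertices n)"
    using bij_betw_vertex_var[OF n] by (rule bij_betw_imp_inj_on)
  have mem: "vertex_var n a \<in> vertex_var n ` q \<longleftrightarrow> a \<in> q" if "a \<in> KD_vertices n" for a
    using inj_on_image_mem_iff[OF inj that q] .
  have y1: "Y 1 \<in> vertex_var n ` q \<longleftrightarrow> W1 \<in> q" using mem[of W1] by (simp add: KD_vertices_def)
  have yn: "Y n \<in> vertex_var n ` q \<longleftrightarrow> NewV \<in> q" using mem[of NewV] by (simp add: KD_vertices_def)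
  have x1n: "X 1 n \<in> vertex_var n ` q \<longleftrightarrow> W2 \<in> q" using mem[of W2] by (simp add: KD_vertices_def)
  have diag: "X i j \<in> vertex_var n ` q \<longleftrightarrow> Diag i j \<in> q" if "Diag i j \<in> diagonals n" for i j
    using mem[of "Diag i j"] that by (simp add: KD_vertices_def)
  have diagonal: "Diag i j \<in> diagonals n" if "Diag i j \<in> q" for i j
    using that q by (auto simp: KD_vertices_def)
  show ?thesis
  proof
    assume good: "good_face n q"
    show "\<not> (\<exists>u v. lead_pair n u v \<and> u \<in> vertex_var n ` q \<and> v \<in> vertex_var n ` q)"
    proof (intro notI, elim exE conjE)
      fix u v assume uv: "lead_pair n u v" "u \<in> vertex_var n ` q" "v \<in> vertex_var n ` q"
      from uv(1) show False
      proof cases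
        case (cross i j k l)
        \<comment> \<open>Crossing chords are never sides of the polygon: each has a vertex strictly
          between its ends and another one outside.\<close>
        then have "Diag i k \<in> diagonals n" "Diag j l \<in> diagonals n" by (auto simp: diagonals_def)
        then have "Diag i k \<in> q" "Diag j l \<in> q" using uv cross diag by auto
        moreover have "crosses (Diag i k) (Diag j l)" using cross by simp
        ultimately show False using good unfolding good_face_def by blast
      next
        case y1_x1n
        then show False using uv y1 x1n good by (simp add: good_face_def)
      next
        case y1_x1n'
        have "Diag 1 (n - 1) \<in> diagonals n" using n by (auto simp: diagonals_def)
        then show False using y1_x1n' uv y1 diag good by (simp add: good_face_def)
      next
        case (yn_xin i)
        then have NewV: "NewV \<in> q" using uv yn by simp
        show False
        proof (cases "i = 1")
          case True
          then show False using NewV yn_xin uv x1n good by (simp add: good_face_def)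
        next
          case False
          then have "Diag i n \<in> diagonals n" using yn_xin n by (auto simp: diagonals_def)
          then have "Diag i n \<in> q" using uv yn_xin diag by simp
          moreover have "crosses (Diag i n) (Diag 1 (n - 1))" using False yn_xin n by auto
          ultimately show False using NewV good unfolding good_face_def by blast
        qed
      qed
    qed
  next
    assume no: "\<not> (\<exists>u v. lead_pair n u v \<and> u \<in> vertex_var n ` q \<and> v \<in> vertex_var n ` q)"
    have cross: "\<not> (i < k \<and> k < j \<and> j < l)" if "Diag i j \<in> q" "Diag k l \<in> q" for i j k l
    proof
      assume less: "i < k \<and> k < j \<and> j < l"
      have "lead_pair n (X i j) (X k l)"
        by (rule lead_pair.cross) (use less diagonal[OF that(1)] diagonal[OF that(2)] in \<open>auto simp: diagonals_def\<close>)
      then show False using no diag diagonal that by blast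
    qed
    have "\<not> crosses d d'" if "d \<in> q" "d' \<in> q" for d d'
      using that cross by (cases d; cases d'; auto)
    moreover have "\<not> (W1 \<in> q \<and> W2 \<in> q)"
      using no lead_pair.y1_x1n[of n] y1 x1n by blast
    moreover have "\<not> (Diag 1 (n - 1) \<in> q \<and> W1 \<in> q)"
      using no lead_pair.y1_x1n'[of n] y1 diag diagonal by blast
    moreover have "W2 \<notin> q" if "NewV \<in> q"
      using no lead_pair.yn_xin[of 1 n] n yn x1n that by auto
    moreover have "\<not> crosses d (Diag 1 (n - 1)) \<and> \<not> crosses (Diag 1 (n - 1)) d" if "NewV \<in> q" "d \<in> q" for d
    proof -
      have noq: "Diag i n \<notin> q" if "1 < i" "i < n - 1" for i
      proof
        assume "Diag i n \<in> q"
        then have "X i n \<in> vertex_var n ` q" using diag diagonal by blast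
        moreover have "lead_pair n (Y n) (X i n)" using that by (intro lead_pair.yn_xin) auto
        ultimately show False using no yn \<open>NewV \<in> q\<close> by blast
      qed
      show ?thesis
      proof (cases d)
        case (Diag a b)
        then have "1 \<le> a" "b \<le> n" using diagonal[of a b] \<open>d \<in> q\<close> by (auto simp: diagonals_def)
        moreover have "\<not> (1 < a \<and> a < n - 1 \<and> n - 1 < b)"
        proof
          assume ab: "1 < a \<and> a < n - 1 \<and> n - 1 < b"
          then have "b = n" using \<open>b \<le> n\<close> by linarith
          then show False using noq[of a] ab Diag \<open>d \<in> q\<close> by simp
        qed
        ultimately show ?thesis using Diag by auto
      qed simp_all
    qed
    ultimately show "good_face n q" unfolding good_face_def by blast
  qed
qed

lemma non_face_iff:
  assumes n: "n \<ge> 5" and p: "p \<subseteq> vertex_var n ` KD_vertices n"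
  shows "p \<notin> (`) (vertex_var n) ` KD_complex n \<longleftrightarrow> (\<exists>u v. lead_pair n u v \<and> u \<in> p \<and> v \<in> p)"
proof -
  obtain q where q: "q \<subseteq> KD_vertices n" "p = vertex_var n ` q"
    using p by (auto elim: subset_imageE)
  have inj: "inj_on (vertex_var n) (KD_vertices n)"
    using bij_betw_vertex_var[OF n] by (rule bij_betw_imp_inj_on)
  have sub: "q' \<subseteq> KD_vertices n" if q': "q' \<in> KD_complex n" for q'
  proof -
    obtain g h where gh: "g \<in> K_complex n" "h \<in> (`) Simp ` simplex (2 * n - 4)" "q' = g \<union> h"
      using q' unfolding KD_complex_def sc_join_def by blast
    have "g \<subseteq> diagonals n \<union> {W1, W2, NewV}" using gh(1) K_complex_iff[OF n] by blast
    moreover have "h \<subseteq> Simp ` {0..2 * n - 4}" using gh(2) by (auto simp: simplex_def)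
    ultimately show ?thesis unfolding KD_vertices_def gh(3) by blast
  qed
  have "p \<in> (`) (vertex_var n) ` KD_complex n \<longleftrightarrow> q \<in> KD_complex n"
  proof
    assume "p \<in> (`) (vertex_var n) ` KD_complex n"
    then obtain q' where q': "q' \<in> KD_complex n" "p = vertex_var n ` q'" by (rule imageE)
    have "q' = q"
      using inj_on_image_eq_iff[OF inj sub[OF q'(1)] q(1)] q(2) q'(2) by simp
    with q'(1) show "q \<in> KD_complex n" by simp
  qed (simp add: q(2))
  then show ?thesis
    unfolding KD_complex_iff[OF n q(1)] good_face_iff[OF n q(1)] q(2) by (simp only: not_not)
qed

section \<open>The Stanley-Reisner ideal and comparison with the initial ideal\<close>

lemma lead_pair_S_vars: "n \<ge> 5 \<Longrightarrow> lead_pair n u v \<Longrightarrow> u \<in> S_vars n \<and> v \<in> S_vars n"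
  by (erule lead_pair.cases) (auto simp: S_vars_iff)

text \<open>Each leading pair is itself a non-face, and each non-face contains a leading pair, so
  its squarefree monomial is a multiple of the monomial of that pair.\<close>

lemma stanley_reisner_KD:
  assumes n: "n \<ge> 5"
  shows "(stanley_reisner_ideal (vertex_var n ` KD_vertices n) ((`) (vertex_var n) ` KD_complex n)
      :: (var, 'k::comm_ring_1) mpoly set)
    = genideal (poly_ring (S_vars n)) {Poly_Mapping.single a 1 |a. a \<in> lead_monomials n}"
    (is "_ = genideal ?R ?M")
proof -
  interpret R: cring ?R by (rule cring_poly_ring)
  have V: "vertex_var n ` KD_vertices n = S_vars n"
    using bij_betw_vertex_var[OF n] by (rule bij_betw_imp_surj_on)
  define F where "F = (`) (vertex_var n) ` KD_complex n"
  let ?N = "{\<Prod>v\<in>p. pvar v |p. p \<subseteq> S_vars n \<and> p \<notin> F} :: (var, 'k) mpoly set"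
  have nf: "p \<notin> F \<longleftrightarrow> (\<exists>u v. lead_pair n u v \<and> u \<in> p \<and> v \<in> p)"
    if "p \<subseteq> S_vars n" for p
    unfolding F_def by (rule non_face_iff[OF n]) (use that V in simp)
  have prod_keys: "Poly_Mapping.keys (\<Prod>v\<in>p. pvar v :: (var, 'k) mpoly) \<subseteq> monomials (S_vars n)"
    if "p \<subseteq> S_vars n" for p
    using that
  proof (induction p rule: infinite_finite_induct)
    case (insert v p)
    then have "Poly_Mapping.keys (pvar v :: (var, 'k) mpoly) \<subseteq> monomials (S_vars n)"
      by (auto simp: pvar_def)
    then show ?case using insert by (simp add: poly_ring_keys_mult)
  qed simp_all
  have M: "?M \<subseteq> carrier ?R"
    using lead_pair_S_vars[OF n] by (auto simp: poly_ring_def lead_monomials_def)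
  have N: "?N \<subseteq> carrier ?R"
    using prod_keys by (auto simp: poly_ring_def)
  have "?M \<subseteq> ?N"
  proof
    fix x assume "x \<in> ?M"
    then obtain u v where uv: "lead_pair n u v" "x = Poly_Mapping.single (pair_monomial u v) 1"
      by (auto simp: lead_monomials_def)
    then have "x = (\<Prod>v\<in>{u, v}. pvar v)" "{u, v} \<subseteq> S_vars n"
      using lead_pair_neq[OF uv(1)] lead_pair_S_vars[OF n uv(1)] by (simp_all add: pvar_mult)
    then show "x \<in> ?N" using nf[of "{u, v}"] uv(1) by blast
  qed
  then have "genideal ?R ?M \<subseteq> genideal ?R ?N"
    by (rule R.subset_Idl_subset[OF N])
  moreover have "?N \<subseteq> genideal ?R ?M"
  proof
    fix x assume "x \<in> ?N"
    then obtain p where p: "x = (\<Prod>v\<in>p. pvar v)" "p \<subseteq> S_vars n" "p \<notin> F" by blast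
    then obtain u v where uv: "lead_pair n u v" "u \<in> p" "v \<in> p" using nf by blast
    have fin: "finite p" using p(2) finite_S_vars by (rule finite_subset)
    have "x = pvar u * (\<Prod>v\<in>p - {u}. pvar v)"
      unfolding p(1) using fin uv by (intro prod.remove) auto
    also have "(\<Prod>v\<in>p - {u}. pvar v) = pvar v * (\<Prod>v\<in>p - {u} - {v}. pvar v :: (var, 'k) mpoly)"
      using fin uv lead_pair_neq[OF uv(1)] by (intro prod.remove) auto
    finally have "x = (\<Prod>v\<in>p - {u} - {v}. pvar v) * Poly_Mapping.single (pair_monomial u v) 1"
      by (simp add: pvar_mult[symmetric] ac_simps)
    moreover have "Poly_Mapping.single (pair_monomial u v) 1 \<in> genideal ?R ?M"
      using R.genideal_self[OF M] uv(1) by (auto simp: lead_monomials_def)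
    ultimately show "x \<in> genideal ?R ?M"
      using ideal_poly_ring_mult[OF R.genideal_ideal[OF M] _ prod_keys[of "p - {u} - {v}"]] p(2) by auto
  qed
  then have "genideal ?R ?N \<subseteq> genideal ?R ?M"
    by (rule R.genideal_minimal[OF R.genideal_ideal[OF M]])
  ultimately show ?thesis unfolding stanley_reisner_ideal_def V F_def by blast
qed

theorem theorem3p1:
  fixes n :: nat and circ :: "var monomial \<Rightarrow> var monomial \<Rightarrow> bool"
  assumes "n \<ge> 5"
    and "circular TYPE('k::alg_closed_field) n circ"
    and "compatible_iii n circ"
  shows "initial_ideal (S_vars n) (term_less n circ) (J_ideal n :: (var, 'k) mpoly set)
    = stanley_reisner_ideal (vertex_var n ` KD_vertices n) ((`) (vertex_var n) ` KD_complex n)"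
proof -
  let ?R = "poly_ring (S_vars n) :: (var, 'k) mpoly ring" and ?lt = "term_less n circ"
  let ?L = "{Poly_Mapping.single (lead_monomial ?lt p) 1 |p. p \<in> (J_ideal n :: (var, 'k) mpoly set) \<and> p \<noteq> 0}
    :: (var, 'k) mpoly set"
  let ?M = "{Poly_Mapping.single a 1 |a. a \<in> lead_monomials n} :: (var, 'k) mpoly set"
  interpret R: cring ?R by (rule cring_poly_ring)
  have ord: "monomial_order (S_vars n) ?lt"
    using assms by (intro monomial_order_term_less) (auto simp: circular_def)
  have divisible: "divisible_by (lead_monomials n) (lead_monomial ?lt p)"
    if "p \<in> (J_ideal n :: (var, 'k) mpoly set)" "p \<noteq> 0" for p
    using lead_monomial_divisible_by[OF ord finite_term_less_below ideal_J_ideal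
      lead_monomial_attained[OF assms(1,2)] J_ideal_standard_eq_0[OF assms(1)] that] .
  have lead_keys: "lead_monomial ?lt p \<in> monomials (S_vars n)"
    if "p \<in> (J_ideal n :: (var, 'k) mpoly set)" "p \<noteq> 0" for p
    using lead_monomial_in_keys[OF ord ideal_poly_ring_keys[OF ideal_J_ideal that(1)] that(2)]
      ideal_poly_ring_keys[OF ideal_J_ideal that(1)] by blast
  have LR: "?L \<subseteq> carrier ?R"
    using lead_keys by (auto simp: poly_ring_def)
  have M_sub: "?M \<subseteq> ?L"
    using lead_monomial_attained[OF assms(1,2)] by blast
  have M: "?M \<subseteq> carrier ?R" using M_sub LR by (rule subset_trans)
  \<comment> \<open>Independence of the standard monomials enters here, through
    \<open>divisible\<close>; the opposite inclusion only needs that the listed monomials are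
    attained.\<close>
  have "?L \<subseteq> genideal ?R ?M"
  proof
    fix x assume "x \<in> ?L"
    then obtain p where p: "p \<in> (J_ideal n :: (var, 'k) mpoly set)" "p \<noteq> 0" "x = Poly_Mapping.single (lead_monomial ?lt p) 1" by blast
    then obtain a w where aw: "a \<in> lead_monomials n" "lead_monomial ?lt p = a + w"
      using divisible[OF p(1,2)] unfolding divisible_by_def by blast
    then have "x = Poly_Mapping.single w 1 * Poly_Mapping.single a 1"
      using p(3) by (simp add: mult_single add.commute)
    moreover have "w \<in> monomials (S_vars n)" using lead_keys[OF p(1,2)] aw by simp
    moreover have "Poly_Mapping.single a 1 \<in> genideal ?R ?M"
      using R.genideal_self[OF M] aw(1) by blast
    ultimately show "x \<in> genideal ?R ?M"
      using ideal_poly_ring_mult[OF R.genideal_ideal[OF M]] by simp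
  qed
  then have "genideal ?R ?L = genideal ?R ?M"
    using R.genideal_minimal[OF R.genideal_ideal[OF M]] R.subset_Idl_subset[OF LR M_sub] by blast
  then show ?thesis
    unfolding initial_ideal_def stanley_reisner_KD[OF assms(1)] .
qed

end
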